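(* Let $p,q,n$ be positive integers, $a\in\{1,-1\}$, and $b=(-1)^{p+q-1}$, with $p\neq 1$ when $b=1$, and $q\neq 1$ when $a=1$. For a positive integer $N$ put $\mathcal{O}_{N}^{(p)}(b)=\sum_{m=1}^{N}\frac{b^{m-1}}{(2m-1)^{p}}$. Then $$\begin{aligned}\sum_{k=1}^\infty\frac{a^k\,\mathcal{O}_{nk}^{(p)}(b)}{k^q}={}&\tfrac{a}{2}(1+(-1)^{q})\,2^{-p}\,\Phi(a,q,1)\,\Phi(b,p,\tfrac12)\\ &+ab^{n-1}n^q(-2)^{-p}\sum_{k=0}^{\lfloor q/2\rfloor}\binom{p+q-2k-1}{p-1}n^{-2k}\,\Phi(ab^n,2k,1)\,\Phi(b,p+q-2k,\tfrac12)\\ &+\tfrac{ab}{2}(-2n)^{-p}\sum_{j=1}^{n}\sum_{k=1}^{p}\binom{p+q-k-1}{q-1}b^j(-1)^{k}\,\Theta(ab^n,k,2j-1,2n)\,\Phi\!\left(a,p+q-k,\tfrac{2n-2j+1}{2n}\right).\end{aligned}$$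
   Context: Lerch function: for $c=\pm1$, integer $q\ge1$ (with $q\neq1$ if $c=1$) and $\alpha>0$, $\Phi(c,q,\alpha)=\sum_{m=0}^\infty \frac{c^m}{(m+\alpha)^q}$. At $q=0$, $\alpha=1$ the values by analytic continuation are used: $\Phi(1,0,1)=\zeta(0)=-\tfrac12$ and $\Phi(-1,0,1)=\eta(0)=\tfrac12$. For $c=\pm1$, integer $k\ge 1$ and $0<s<r$: $\Theta(c,k,s,r)=\Phi(c,k,\tfrac{s}{r})+c(-1)^{k}\Phi(c,k,\tfrac{r-s}{r})$ if $(c,k)\ne(1,1)$, and $\Theta(1,1,s,r)=\pi\cot(\pi s/r)$. *)

theory Defs
  imports Complex_Main
begin

(* The intended range is c = 1 or c = -1 and alpha > 0, with q \<ge> 2 if c = 1. For c = -1 and q = 1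
   the series converges only conditionally; suminf is the limit of partial sums, so it still
   has the right value. For q = 0, alpha = 1 the series diverges, and the value is that of the
   analytic continuation, namely zeta(0) = -1/2 for c = 1 and eta(0) = 1/2 for c = -1. *)
definition Lerch_Phi :: "real \<Rightarrow> nat \<Rightarrow> real \<Rightarrow> real" where
  "Lerch_Phi c q \<alpha> =
     (if q = 0 \<and> \<alpha> = 1 then (if c = 1 then - 1 / 2 else 1 / 2)
      else (\<Sum>m. c ^ m / (real m + \<alpha>) ^ q))"

definition Lerch_Theta :: "real \<Rightarrow> nat \<Rightarrow> real \<Rightarrow> real \<Rightarrow> real" where
  "Lerch_Theta c k s r =
     (if c = 1 \<and> k = 1 then pi * cot (pi * s / r)
      else Lerch_Phi c k (s / r) + c * (- 1) ^ k * Lerch_Phi c k ((r - s) / r))"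

definition odd_harmonic :: "nat \<Rightarrow> real \<Rightarrow> nat \<Rightarrow> real" where
  "odd_harmonic p b N = (\<Sum>m = 1..N. b ^ (m - 1) / real (2 * m - 1) ^ p)"

end

theory Submission
  imports Defs "HOL-Analysis.Gamma_Function"
begin

text \<open>
  Let \<open>c = a b\<^sup>n\<close> and evaluate the double series
  \<open>\<Sum> c\<^sup>k b\<^sup>m / (k\<^sup>q (m + 1/2 - n k)\<^sup>p)\<close> over \<open>k \<noteq> 0\<close> and \<open>m \<ge> 0\<close> in both orders. For fixed \<open>k\<close>, the sum
  over \<open>m\<close> is \<open>\<Phi>(b, p, 1/2)\<close> shifted by \<open>\<plusminus> n k\<close> terms, which produces the odd harmonic numbers; the choice
  of \<open>b\<close> makes the contributions of \<open>k\<close> and \<open>- k\<close> add up. For fixed \<open>m\<close>, partial fractions in \<open>k\<close> give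
  values \<open>\<Phi>(c, 2 i, 1)\<close> and \<open>\<Theta>(c, j, y, 1)\<close> at \<open>y = (m + 1/2) / n\<close>, which are quasi-periodic under
  \<open>y \<mapsto> y + 1\<close>, so that grouping \<open>m = l n + r\<close> leads to the right-hand side. The double series need not converge
  absolutely, so both orders are compared on the box \<open>\<bar>k\<bar> \<le> K\<close>, \<open>m < n K\<close>: since
  \<open>\<bar>\<Sum>m<N. b\<^sup>m / (m + x)\<^sup>p\<bar> = O(1 / x)\<close> uniformly in \<open>N\<close> whenever \<open>(b, p) \<noteq> (1, 1)\<close>, both errors are
  dominated by sums that are \<open>o(1)\<close>, namely \<open>\<Sum>k\<le>K. 1 / (k (K + 1 - k))\<close> and \<open>\<Sum>j\<ge>1. 1 / ((K + j) j)\<close>.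
\<close>

section \<open>Partial fractions of \<open>1 / (u ^ q * v ^ p)\<close>\<close>

text \<open>Read \<open>A = 1 / u\<close>, \<open>B = 1 / v\<close>, \<open>t = 1 / (u + v)\<close>.
  The relation \<open>A * B = t * (A + B)\<close> trades a product for two products of degree one
  less, so the coefficients satisfy Pascal's recursion. This form is free of division.\<close>

lemma partial_fractions_aux:
  fixes A B t :: "'a::comm_ring_1"
  assumes AB: "A * B = t * (A + B)"
  shows "A ^ Suc Q * B ^ Suc P =
    (\<Sum>i\<le>Q. of_nat ((P + Q - i) choose P) * A ^ Suc i * t ^ Suc (P + Q - i)) +
    (\<Sum>j\<le>P. of_nat ((P + Q - j) choose Q) * B ^ Suc j * t ^ Suc (P + Q - j))"
proof (induction "P + Q" arbitrary: P Q rule: less_induct)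
  case less
  define F where "F P Q = (\<Sum>i\<le>Q. of_nat ((P + Q - i) choose P) * A ^ Suc i * t ^ Suc (P + Q - i))"
    for P Q
  define G where "G P Q = (\<Sum>j\<le>P. of_nat ((P + Q - j) choose Q) * B ^ Suc j * t ^ Suc (P + Q - j))"
    for P Q
  have IH: "A ^ Suc Q' * B ^ Suc P' = F P' Q' + G P' Q'" if "P' + Q' < P + Q" for P' Q'
    using less[OF that] by (simp add: F_def G_def)
  have F_eq: "F (Suc P) (Suc Q) = t * (F (Suc P) Q + F P (Suc Q))" for P Q
  proof -
    \<comment> \<open>The added term \<open>i = Suc Q\<close> has coefficient
      \<open>P choose Suc P = 0\<close>. With equal ranges, Pascal's rule applies term by
      term.\<close>
    have "F (Suc P) Q = (\<Sum>i\<le>Suc Q. of_nat ((Suc P + Q - i) choose Suc P) * A ^ Suc i * t ^ Suc (Suc P + Q - i))"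
      unfolding F_def by (simp add: binomial_eq_0 del: power_Suc)
    then have "t * (F (Suc P) Q + F P (Suc Q)) =
      (\<Sum>i\<le>Suc Q. (of_nat ((Suc P + Q - i) choose Suc P) + of_nat ((Suc P + Q - i) choose P))
         * A ^ Suc i * t ^ Suc (Suc (Suc P + Q - i)))"
      unfolding F_def by (simp only: sum.distrib [symmetric] sum_distrib_left)
        (intro sum.cong; simp add: algebra_simps)
    also have "\<dots> = F (Suc P) (Suc Q)"
      unfolding F_def
    proof (rule sum.cong, goal_cases)
      case (2 i)
      then have "Suc P + Suc Q - i = Suc (Suc P + Q - i)" by simp
      then show ?case by (simp add: add.commute)
    qed simp
    finally show ?thesis by simp
  qed
  have G_eq: "G (Suc P) (Suc Q) = t * (G (Suc P) Q + G P (Suc Q))" for P Q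
  proof -
    have "G P (Suc Q) = (\<Sum>j\<le>Suc P. of_nat ((Suc P + Q - j) choose Suc Q) * B ^ Suc j * t ^ Suc (Suc P + Q - j))"
      unfolding G_def by (simp add: binomial_eq_0 del: power_Suc)
    then have "t * (G (Suc P) Q + G P (Suc Q)) =
      (\<Sum>j\<le>Suc P. (of_nat ((Suc P + Q - j) choose Q) + of_nat ((Suc P + Q - j) choose Suc Q))
         * B ^ Suc j * t ^ Suc (Suc (Suc P + Q - j)))"
      unfolding G_def by (simp only: sum.distrib [symmetric] sum_distrib_left)
        (intro sum.cong; simp add: algebra_simps)
    also have "\<dots> = G (Suc P) (Suc Q)"
      unfolding G_def
    proof (rule sum.cong, goal_cases)
      case (2 i)
      then have "Suc P + Suc Q - i = Suc (Suc P + Q - i)" by simp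
      then show ?case by simp
    qed simp
    finally show ?thesis by simp
  qed
  \<comment> \<open>Boundary recursions: when an exponent drops to zero, a bare power of
    \<open>A\<close> or \<open>B\<close> is left, and it becomes the top term of the new
    \<open>F\<close> or \<open>G\<close>.\<close>
  have F0: "F (Suc P) 0 = t * F P 0" for P
    by (simp add: F_def algebra_simps)
  have G0: "G 0 (Suc Q) = t * G 0 Q" for Q
    by (simp add: G_def algebra_simps)
  have G1: "G (Suc P) 0 = t * (B ^ Suc (Suc P) + G P 0)" for P
    unfolding G_def by (simp add: algebra_simps sum_distrib_left Suc_diff_le)
  have F1: "F 0 (Suc Q) = t * (A ^ Suc (Suc Q) + F 0 Q)" for Q
    unfolding F_def by (simp add: algebra_simps sum_distrib_left Suc_diff_le)
  have step: "A ^ Suc Q * B ^ Suc P = t * (A ^ Suc Q * B ^ P + A ^ Q * B ^ Suc P)"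
  proof -
    have "A ^ Suc Q * B ^ Suc P = (A * B) * (A ^ Q * B ^ P)" by (simp add: algebra_simps)
    then show ?thesis by (simp add: AB algebra_simps)
  qed
  have "A ^ Suc Q * B ^ Suc P = F P Q + G P Q"
  proof (cases P)
    case 0
    show ?thesis
    proof (cases Q)
      case 0
      with \<open>P = 0\<close> show ?thesis using AB by (simp add: F_def G_def algebra_simps)
    next
      case (Suc Q')
      have "A ^ Suc Q' * B ^ Suc 0 = F 0 Q' + G 0 Q'"
        using IH[of 0 Q'] Suc \<open>P = 0\<close> by simp
      then show ?thesis unfolding step
        using \<open>P = 0\<close> Suc by (simp add: F1 G0 algebra_simps del: power_Suc)
    qed
  next
    case (Suc P')
    note P' = this
    show ?thesis
    proof (cases Q)
      case 0
      have "A ^ Suc 0 * B ^ Suc P' = F P' 0 + G P' 0"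
        using IH[of P' 0] Suc \<open>Q = 0\<close> by simp
      then show ?thesis unfolding step
        using \<open>Q = 0\<close> Suc by (simp add: F0 G1 algebra_simps del: power_Suc)
    next
      case (Suc Q')
      have "A ^ Suc Q * B ^ Suc P' = F P' (Suc Q') + G P' (Suc Q')"
        using IH[of P' Q] Suc P' by simp
      moreover have "A ^ Suc Q' * B ^ Suc P = F (Suc P') Q' + G (Suc P') Q'"
        using IH[of P Q'] Suc P' by simp
      ultimately show ?thesis unfolding step
        using Suc P' by (simp only: F_eq G_eq) (simp add: algebra_simps)
    qed
  qed
  then show ?case unfolding F_def G_def .
qed

lemma partial_fractions:
  fixes u v :: "'a::field"
  assumes "u \<noteq> 0" "v \<noteq> 0" "u + v \<noteq> 0" "p \<ge> 1" "q \<ge> 1"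
  shows "1 / (u ^ q * v ^ p) =
    (\<Sum>i=1..q. of_nat ((p + q - i - 1) choose (p - 1)) / (u ^ i * (u + v) ^ (p + q - i))) +
    (\<Sum>j=1..p. of_nat ((p + q - j - 1) choose (q - 1)) / (v ^ j * (u + v) ^ (p + q - j)))"
proof -
  obtain P Q where PQ: "p = Suc P" "q = Suc Q"
    using assms by (metis Suc_le_D One_nat_def)
  have "1 / u * (1 / v) = 1 / (u + v) * (1 / u + 1 / v)"
    using assms by (simp add: field_simps)
  note * = partial_fractions_aux[OF this, of Q P]
  have ivl: "{1..Suc N} = Suc ` {..N}" for N
    by (simp add: image_Suc_atMost)
  have "1 / (u ^ q * v ^ p) = (1 / u) ^ Suc Q * (1 / v) ^ Suc P"
    by (simp add: PQ power_divide del: power_Suc)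
  also note *
  also have "(\<Sum>i\<le>Q. of_nat ((P + Q - i) choose P) * (1 / u) ^ Suc i * (1 / (u + v)) ^ Suc (P + Q - i)) =
    (\<Sum>i=1..q. of_nat ((p + q - i - 1) choose (p - 1)) / (u ^ i * (u + v) ^ (p + q - i)))"
    unfolding PQ ivl
    by (subst sum.reindex) (auto simp: power_divide Suc_diff_le simp del: power_Suc intro!: sum.cong)
  also have "(\<Sum>j\<le>P. of_nat ((P + Q - j) choose Q) * (1 / v) ^ Suc j * (1 / (u + v)) ^ Suc (P + Q - j)) =
    (\<Sum>j=1..p. of_nat ((p + q - j - 1) choose (q - 1)) / (v ^ j * (u + v) ^ (p + q - j)))"
    unfolding PQ ivl
    by (subst sum.reindex) (auto simp: power_divide Suc_diff_le simp del: power_Suc intro!: sum.cong)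
  finally show ?thesis .
qed

section \<open>Uniform bounds and convergence of Lerch series\<close>

text \<open>Induction over all \<open>f\<close> at once: the sum is \<open>f 0\<close> minus the
  alternating sum of the shifted sequence, which the induction hypothesis places between
  \<open>0\<close> and \<open>f 1\<close>.\<close>

lemma alternating_partial_sum_bounds:
  fixes f :: "nat \<Rightarrow> real"
  assumes "\<And>m. f m \<ge> 0" "\<And>m. f (Suc m) \<le> f m"
  shows "0 \<le> (\<Sum>m<N. (- 1) ^ m * f m) \<and> (\<Sum>m<N. (- 1) ^ m * f m) \<le> f 0"
  using assms
proof (induction N arbitrary: f)
  case (Suc N)
  have "(\<Sum>m<Suc N. (- 1) ^ m * f m) = f 0 - (\<Sum>m<N. (- 1) ^ m * f (Suc m))"
    by (simp add: sum.lessThan_Suc_shift sum_negf del: sum.lessThan_Suc)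
  moreover have "0 \<le> (\<Sum>m<N. (- 1) ^ m * f (Suc m)) \<and> (\<Sum>m<N. (- 1) ^ m * f (Suc m)) \<le> f (Suc 0)"
    by (rule Suc.IH) (simp_all add: Suc.prems)
  ultimately show ?case using Suc.prems(2)[of 0] by linarith
qed (simp add: assms)

lemma sum_inverse_squares_le:
  fixes x :: real
  assumes "x > 0"
  shows "(\<Sum>m<N. 1 / (real m + x) ^ 2) \<le> 1 / x ^ 2 + 1 / x"
proof -
  \<comment> \<open>Subtracting \<open>1 / (N + x)\<close> makes the induction close, since
    \<open>1 / (y + 1)^2\<close> is at most the telescoping difference
    \<open>1 / y - 1 / (y + 1)\<close>.\<close>
  have "(\<Sum>m<Suc N. 1 / (real m + x) ^ 2) \<le> 1 / x ^ 2 + 1 / x - 1 / (real N + x)" for N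
  proof (induction N)
    case (Suc N)
    define y where "y = real N + x"
    have y: "y > 0" using assms by (simp add: y_def)
    have "1 / (y + 1) ^ 2 \<le> 1 / (y * (y + 1))"
      using y by (intro frac_le) (auto simp: power2_eq_square)
    also have "\<dots> = 1 / y - 1 / (y + 1)" using y by (simp add: field_simps)
    finally show ?case using Suc by (simp add: y_def algebra_simps)
  qed simp
  from this[of "N"] have "(\<Sum>m<Suc N. 1 / (real m + x) ^ 2) \<le> 1 / x ^ 2 + 1 / x"
    using assms by (smt (verit) divide_nonneg_nonneg of_nat_0_le_iff)
  moreover have "(\<Sum>m<N. 1 / (real m + x) ^ 2) \<le> (\<Sum>m<Suc N. 1 / (real m + x) ^ 2)" by simp
  ultimately show ?thesis by linarith
qed

lemma abs_pm1_power: "b \<in> {1, - 1 :: real} \<Longrightarrow> \<bar>b ^ m\<bar> = 1"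
  by (auto simp: power_abs)

text \<open>For \<open>b = 1\<close> the exponent is at least 2 and the sum is compared with inverse
  squares; for \<open>b = - 1\<close> the first term dominates. As \<open>2 * x >= 1\<close>,
  surplus powers of \<open>1 / x\<close> cost only powers of 2, which gives decay
  \<open>1 / x\<close> uniformly in \<open>N\<close>.\<close>

lemma Lerch_partial_sum_bound:
  fixes b x :: real
  assumes b: "b \<in> {1, - 1}" and p: "p \<ge> 1" "b = 1 \<Longrightarrow> p \<noteq> 1" and x: "x \<ge> 1 / 2"
  shows "\<bar>\<Sum>m<N. b ^ m / (real m + x) ^ p\<bar> \<le> 3 * 2 ^ p / x"
proof -
  have pow: "1 / y ^ (d + k) \<le> 2 ^ k * (1 / y ^ d)" if "y \<ge> 1 / 2" for y :: real and d k
  proof -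
    have "1 \<le> (2 * y) ^ k" using that by (intro one_le_power) simp
    then show ?thesis using that by (simp add: field_simps power_add power_mult_distrib)
  qed
  show ?thesis
  proof (cases "b = 1")
    case True
    then obtain k where k: "p = 2 + k" using p by (metis Suc_1 Suc_leI le_Suc_ex le_neq_implies_less One_nat_def)
    have "(\<Sum>m<N. b ^ m / (real m + x) ^ p) \<le> (\<Sum>m<N. 2 ^ k * (1 / (real m + x) ^ 2))"
      using True x unfolding k by (intro sum_mono) (simp only: power_one, intro pow, simp)
    also have "\<dots> \<le> 2 ^ k * (1 / x ^ 2 + 1 / x)"
      unfolding sum_distrib_left [symmetric] using x
      by (intro mult_left_mono sum_inverse_squares_le) auto
    also have "1 / x ^ 2 \<le> 2 / x" using x by (simp add: field_simps power2_eq_square)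
    then have "2 ^ k * (1 / x ^ 2 + 1 / x) \<le> 2 ^ k * (3 / x)" by (intro mult_left_mono) auto
    also have "\<dots> \<le> 3 * 2 ^ p / x" using x by (simp add: k field_simps)
    finally show ?thesis using True x by (subst abs_of_nonneg) (auto intro!: sum_nonneg)
  next
    case False
    then have b1: "b = - 1" using b by simp
    obtain k where k: "p = 1 + k" using p by (metis le_Suc_ex)
    have "0 \<le> (\<Sum>m<N. (- 1) ^ m * (1 / (real m + x) ^ p)) \<and>
      (\<Sum>m<N. (- 1) ^ m * (1 / (real m + x) ^ p)) \<le> 1 / (real 0 + x) ^ p"
      by (intro alternating_partial_sum_bounds) (use x in \<open>auto intro!: divide_left_mono power_mono mult_pos_pos\<close>)
    moreover have "1 / x ^ p \<le> 3 * 2 ^ p / x"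
      using pow[OF x, of 1 k] x by (simp add: k field_simps)
    ultimately show ?thesis by (simp add: b1)
  qed
qed

lemma summable_Lerch:
  fixes b x :: real
  assumes b: "b \<in> {1, - 1}" and p: "p \<ge> 1" "b = 1 \<Longrightarrow> p \<noteq> 1" and x: "x > 0"
  shows "summable (\<lambda>m. b ^ m / (real m + x) ^ p)"
proof (cases "b = 1")
  case True
  then have p2: "p \<ge> 2" using p by simp
  have "summable (\<lambda>m. 1 / (real (Suc m)) ^ p)"
    using inverse_power_summable[OF p2, where 'a = real]
    by (subst summable_Suc_iff[where f = "\<lambda>m. 1 / real m ^ p"]) (simp add: inverse_eq_divide)
  then have "summable (\<lambda>m. 1 / (real (Suc m) + x) ^ p)"
  proof (rule summable_comparison_test'[where N = 0])
    show "norm (1 / (real (Suc m) + x) ^ p) \<le> 1 / (real (Suc m)) ^ p" for m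
      using x by (simp add: frac_le power_mono)
  qed
  then show ?thesis
    using True summable_Suc_iff[where f = "\<lambda>m. 1 / (real m + x) ^ p"] by simp
next
  case False
  then have b1: "b = - 1" using b by simp
  have "filterlim (\<lambda>m. real m + x) at_infinity sequentially"
    using filterlim_tendsto_add_at_top[OF tendsto_const filterlim_real_sequentially, of x]
    by (intro filterlim_at_top_imp_at_infinity) (simp add: add.commute)
  then have "(\<lambda>m. 1 / (real m + x)) \<longlonglongrightarrow> 0" by (intro tendsto_divide_0[OF tendsto_const])
  then have "(\<lambda>m. (1 / (real m + x)) ^ p) \<longlonglongrightarrow> 0 ^ p" by (intro tendsto_intros)
  then have "(\<lambda>m. 1 / (real m + x) ^ p) \<longlonglongrightarrow> 0" using p by (simp add: power_divide power_0_left)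
  then have "summable (\<lambda>m. (- 1) ^ m * (1 / (real m + x) ^ p))"
    using x by (intro summable_Leibniz') (auto intro!: divide_left_mono power_mono)
  then show ?thesis by (simp add: b1)
qed

lemma Lerch_suminf_bound:
  fixes b x :: real
  assumes b: "b \<in> {1, - 1}" and p: "p \<ge> 1" "b = 1 \<Longrightarrow> p \<noteq> 1" and x: "x \<ge> 1 / 2"
  shows "\<bar>\<Sum>m. b ^ m / (real m + x) ^ p\<bar> \<le> 3 * 2 ^ p / x"
proof (rule LIMSEQ_le_const2)
  show "(\<lambda>N. \<bar>\<Sum>m<N. b ^ m / (real m + x) ^ p\<bar>) \<longlonglongrightarrow> \<bar>\<Sum>m. b ^ m / (real m + x) ^ p\<bar>"
    using x by (intro tendsto_rabs summable_LIMSEQ summable_Lerch assms) auto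
qed (use Lerch_partial_sum_bound[OF assms] in auto)

section \<open>The cotangent series\<close>

text \<open>This is the logarithmic derivative of the reflection formula for Gamma. The limit
  formula for Digamma turns the difference of the two Digamma values into the series, the logarithms
  cancelling.\<close>

lemma sums_cot_partial_fractions:
  fixes y :: real
  assumes y: "0 < y" "y < 1"
  shows "(\<lambda>k. 1 / (real k + y) - 1 / (real k + (1 - y))) sums (pi * cot (pi * y))"
proof -
  have refl: "Gamma x * Gamma (1 - x) * sin (pi * x) = pi" if x: "0 < x" "x < 1" for x :: real
  proof -
    have "Gamma (complex_of_real x) * Gamma (1 - complex_of_real x)
        = of_real pi / sin (of_real pi * complex_of_real x)"
      by (rule Gamma_reflection_complex)
    moreover have "1 - complex_of_real x = complex_of_real (1 - x)"
      and "of_real pi * complex_of_real x = complex_of_real (pi * x)" by simp_all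
    ultimately have "complex_of_real (Gamma x) * complex_of_real (Gamma (1 - x))
        = complex_of_real pi / complex_of_real (sin (pi * x))"
      by (simp only: Gamma_complex_of_real sin_of_real)
    then have "complex_of_real (Gamma x * Gamma (1 - x)) = complex_of_real (pi / sin (pi * x))"
      by (simp only: of_real_mult of_real_divide)
    then have "Gamma x * Gamma (1 - x) = pi / sin (pi * x)"
      by (simp only: of_real_eq_iff)
    moreover have "sin (pi * x) > 0" using x by (intro sin_gt_zero) auto
    ultimately show ?thesis by simp
  qed
  \<comment> \<open>The derivative by the product rule of a function that is constantly
    \<open>pi\<close> on the unit interval; hence \<open>D = 0\<close>.\<close>
  define D where "D = Gamma y * Digamma y * (Gamma (1 - y) * sin (pi * y))
     - Gamma y * (Gamma (1 - y) * Digamma (1 - y)) * sin (pi * y) + Gamma y * Gamma (1 - y) * (pi * cos (pi * y))"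
  have nonpos: "y \<notin> \<int>\<^sub>\<le>\<^sub>0" "1 - y \<notin> \<int>\<^sub>\<le>\<^sub>0" using y by (auto elim!: nonpos_Ints_cases)
  have "((\<lambda>x. Gamma x * Gamma (1 - x) * sin (pi * x)) has_real_derivative D) (at y)"
    using nonpos by (auto intro!: derivative_eq_intros simp: D_def algebra_simps)
  moreover have "((\<lambda>x. Gamma x * Gamma (1 - x) * sin (pi * x)) has_real_derivative 0) (at y)"
  proof (rule has_field_derivative_transform_within_open[where S = "{0<..<1}"])
    show "((\<lambda>x. pi) has_real_derivative 0) (at y)" by simp
  qed (use y refl in auto)
  ultimately have "D = 0" by (rule DERIV_unique)
  moreover have "D = pi * (Digamma y - Digamma (1 - y)) + pi * (pi * cot (pi * y))"
  proof -
    have s: "sin (pi * y) > 0" using y by (intro sin_gt_zero) auto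
    have "D = (Gamma y * Gamma (1 - y) * sin (pi * y)) * (Digamma y - Digamma (1 - y))
      + (Gamma y * Gamma (1 - y) * sin (pi * y)) * (pi * cot (pi * y))"
      using s by (simp add: D_def cot_def algebra_simps)
    then show ?thesis using refl[OF y] by simp
  qed
  ultimately have *: "Digamma (1 - y) - Digamma y = pi * cot (pi * y)"
    by (simp flip: distrib_left)
  have "(\<lambda>m. (of_real (ln (real m)) - (\<Sum>n<m. inverse (1 - y + of_nat n)))
      - (of_real (ln (real m)) - (\<Sum>n<m. inverse (y + of_nat n)))) \<longlonglongrightarrow> Digamma (1 - y) - Digamma y"
    using y by (intro tendsto_diff Digamma_LIMSEQ) auto
  then show ?thesis
    unfolding sums_def * by (simp add: sum_subtractf inverse_eq_divide add.commute)
qed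

section \<open>Lerch series with shifted arguments\<close>

lemma pm1_power_mult_self: "b \<in> {1, - 1 :: real} \<Longrightarrow> b ^ m * b ^ m = 1"
  by (auto simp flip: power_mult_distrib)

lemma Lerch_Phi_sums:
  assumes "b \<in> {1, - 1}" "p \<ge> 1" "b = 1 \<Longrightarrow> p \<noteq> 1" "x > 0"
  shows "(\<lambda>m. b ^ m / (real m + x) ^ p) sums Lerch_Phi b p x"
  using summable_sums[OF summable_Lerch[OF assms]] assms by (simp add: Lerch_Phi_def)

text \<open>Reverse the order of summation. The argument \<open>1 / 2 - M\<close> is taken back to
  \<open>1 / 2\<close>, and a block of negative bases becomes a block of positive ones.\<close>

lemma Lerch_partial_sum_reflect:
  assumes b: "b \<in> {1, - 1}"
  shows "(\<Sum>m<M. b ^ m / (real m + z) ^ p) =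
    b ^ M * b * (- 1) ^ p * (\<Sum>i<M. b ^ i / (real i + (1 - real M - z)) ^ p)"
proof -
  have "(\<Sum>m<M. b ^ m / (real m + z) ^ p) = (\<Sum>i<M. b ^ (M - Suc i) / (real (M - Suc i) + z) ^ p)"
    by (rule sum.nat_diff_reindex [symmetric])
  also have "\<dots> = (\<Sum>i<M. b ^ M * b * (- 1) ^ p * (b ^ i / (real i + (1 - real M - z)) ^ p))"
  proof (rule sum.cong [OF refl])
    fix i assume "i \<in> {..<M}"
    then have i: "i < M" by simp
    have "b ^ M = b ^ (M - Suc i) * b ^ Suc i"
      unfolding power_add [symmetric] using i by simp
    then have "b ^ M * b * b ^ i = b ^ (M - Suc i) * (b ^ Suc i * b ^ Suc i)" by (simp add: mult_ac)
    then have pow: "b ^ (M - Suc i) = b ^ M * b * b ^ i"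
      unfolding pm1_power_mult_self[OF b] by simp
    have "real (M - Suc i) + z = (- 1) * (real i + (1 - real M - z))"
      using i by (simp add: of_nat_diff)
    then have den: "(real (M - Suc i) + z) ^ p = (- 1) ^ p * (real i + (1 - real M - z)) ^ p"
      by (simp only: power_mult_distrib)
    show "b ^ (M - Suc i) / (real (M - Suc i) + z) ^ p =
        b ^ M * b * (- 1) ^ p * (b ^ i / (real i + (1 - real M - z)) ^ p)"
      unfolding pow den by (cases "even p") auto
  qed
  finally show ?thesis by (simp add: sum_distrib_left)
qed

lemma odd_harmonic_eq:
  "2 ^ p * odd_harmonic p b N = (\<Sum>m<N. b ^ m / (real m + 1 / 2) ^ p)"
proof -
  have "odd_harmonic p b N = (\<Sum>m<N. b ^ m / real (2 * Suc m - 1) ^ p)"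
    unfolding odd_harmonic_def
    by (rule sum.reindex_bij_witness[of _ Suc "\<lambda>m. m - 1"]) auto
  moreover have "real (2 * Suc m - 1) = 2 * (real m + 1 / 2)" for m by simp
  ultimately show ?thesis
    by (simp only: power_mult_distrib sum_distrib_left) simp
qed

text \<open>A shift by \<open>N\<close> deletes the first \<open>N\<close> terms of the series at
  \<open>1 / 2\<close>. A shift by \<open>- N\<close> prepends \<open>N\<close> terms with negative
  base, which by reflection are the same block up to sign.\<close>

lemma Lerch_Phi_sums_shift:
  assumes b: "b \<in> {1, - 1}" and p: "p \<ge> 1" "b = 1 \<Longrightarrow> p \<noteq> 1"
  shows "(\<lambda>m. b ^ m / (real m + (1 / 2 + real N)) ^ p) sums
      (b ^ N * (Lerch_Phi b p (1 / 2) - 2 ^ p * odd_harmonic p b N))" (is ?A)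
    and "(\<lambda>m. b ^ m / (real m + (1 / 2 - real N)) ^ p) sums
      (b ^ N * (Lerch_Phi b p (1 / 2) + b * (- 1) ^ p * 2 ^ p * odd_harmonic p b N))" (is ?B)
proof -
  have F: "(\<lambda>m. b ^ m / (real m + 1 / 2) ^ p) sums Lerch_Phi b p (1 / 2)"
    by (intro Lerch_Phi_sums assms) auto
  have "(\<lambda>m. b ^ (m + N) / (real (m + N) + 1 / 2) ^ p) sums
      (Lerch_Phi b p (1 / 2) - 2 ^ p * odd_harmonic p b N)"
    unfolding odd_harmonic_eq by (rule sums_split_initial_segment[OF F])
  then have "(\<lambda>m. b ^ N * (b ^ (m + N) / (real (m + N) + 1 / 2) ^ p)) sums
      (b ^ N * (Lerch_Phi b p (1 / 2) - 2 ^ p * odd_harmonic p b N))"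
    by (rule sums_mult)
  moreover have "b ^ N * (b ^ (m + N) / (real (m + N) + 1 / 2) ^ p) =
      b ^ m / (real m + (1 / 2 + real N)) ^ p" for m
  proof -
    have "b ^ N * b ^ (m + N) = b ^ m * (b ^ N * b ^ N)" by (simp add: power_add)
    also have "\<dots> = b ^ m" using pm1_power_mult_self[OF b] by simp
    finally show ?thesis by (simp add: add_ac)
  qed
  ultimately show ?A by simp
  have "(\<Sum>m<N. b ^ m / (real m + (1 / 2 - real N)) ^ p) =
      b ^ N * b * (- 1) ^ p * (2 ^ p * odd_harmonic p b N)"
    unfolding odd_harmonic_eq by (subst Lerch_partial_sum_reflect[OF b]) simp
  moreover have "(\<lambda>m. b ^ (m + N) / (real (m + N) + (1 / 2 - real N)) ^ p) sums
      (b ^ N * Lerch_Phi b p (1 / 2))"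
    using sums_mult[OF F, of "b ^ N"] by (simp add: power_add mult_ac)
  ultimately show ?B
    by (subst (asm) sums_iff_shift) (simp add: algebra_simps)
qed

text \<open>The tail from \<open>M\<close> on is, up to the sign \<open>b ^ M\<close>, a Lerch
  series at \<open>M + z\<close>. Thus \<open>z\<close> itself may be negative, as happens for the
  shifts by \<open>- n * k\<close>.\<close>

lemma Lerch_tail_bound:
  assumes b: "b \<in> {1, - 1}" and p: "p \<ge> 1" "b = 1 \<Longrightarrow> p \<noteq> 1"
    and S: "(\<lambda>m. b ^ m / (real m + z) ^ p) sums S" and z: "real M + z \<ge> 1 / 2"
  shows "\<bar>(\<Sum>m<M. b ^ m / (real m + z) ^ p) - S\<bar> \<le> 3 * 2 ^ p / (real M + z)"
proof -
  have "(\<lambda>m. b ^ (m + M) / (real (m + M) + z) ^ p) sums (S - (\<Sum>m<M. b ^ m / (real m + z) ^ p))"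
    by (rule sums_split_initial_segment[OF S])
  moreover have "b ^ (m + M) / (real (m + M) + z) ^ p = b ^ M * (b ^ m / (real m + (real M + z)) ^ p)" for m
    unfolding of_nat_add add.assoc power_add by simp
  ultimately have "(\<lambda>m. b ^ M * (b ^ m / (real m + (real M + z)) ^ p)) sums
      (S - (\<Sum>m<M. b ^ m / (real m + z) ^ p))"
    by (simp only:)
  moreover have "(\<lambda>m. b ^ M * (b ^ m / (real m + (real M + z)) ^ p)) sums
      (b ^ M * (\<Sum>m. b ^ m / (real m + (real M + z)) ^ p))"
    using z by (intro sums_mult summable_sums summable_Lerch b p) auto
  ultimately have "S - (\<Sum>m<M. b ^ m / (real m + z) ^ p) =
      b ^ M * (\<Sum>m. b ^ m / (real m + (real M + z)) ^ p)"
    by (rule sums_unique2)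
  then have "\<bar>(\<Sum>m<M. b ^ m / (real m + z) ^ p) - S\<bar> =
      \<bar>\<Sum>m. b ^ m / (real m + (real M + z)) ^ p\<bar>"
    by (simp only: abs_minus_commute[of _ S] abs_mult abs_pm1_power[OF b] mult_1)
  then show ?thesis
    using Lerch_suminf_bound[OF b p z] by (simp only:)
qed

section \<open>A vanishing harmonic convolution\<close>

text \<open>Any bound of order below \<open>K\<close> serves the convolution below; the square root
  gives one by telescoping.\<close>

lemma harm_le_sqrt: "(\<Sum>k<K. 1 / real (Suc k)) \<le> 2 * sqrt (real K)"
proof (induction K)
  case (Suc K)
  have "1 / real (Suc K) \<le> 2 * (sqrt (real (Suc K)) - sqrt (real K))"
  proof -
    have s: "sqrt (real (Suc K)) > 0" "sqrt (real K) \<le> sqrt (real (Suc K))" "sqrt (real K) \<ge> 0" "sqrt (real (Suc K)) \<ge> 1"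
      by auto
    have "1 = (sqrt (real (Suc K)) - sqrt (real K)) * (sqrt (real (Suc K)) + sqrt (real K))"
      by (simp add: algebra_simps)
    also have "\<dots> \<le> (sqrt (real (Suc K)) - sqrt (real K)) * (2 * real (Suc K))"
    proof (rule mult_left_mono)
      have "sqrt (real (Suc K)) \<le> sqrt (real (Suc K)) * sqrt (real (Suc K))"
        using mult_left_mono[OF s(4), of "sqrt (real (Suc K))"] s by simp
      then have "sqrt (real (Suc K)) \<le> real (Suc K)" by simp
      then show "sqrt (real (Suc K)) + sqrt (real K) \<le> 2 * real (Suc K)"
        using s(2) by (metis add_mono mult_2 order_trans)
    qed (use s in simp)
    finally show ?thesis by (simp add: field_simps)
  qed
  then show ?case using Suc by simp
qed simp

text \<open>The two factors of each denominator add up to \<open>K + 1\<close>, so partial fractions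
  reduce the sum to twice the harmonic sum divided by \<open>K + 1\<close>.\<close>

lemma harmonic_convolution_tendsto_0:
  "(\<lambda>K. \<Sum>k<K. 1 / (real (Suc k) * (real K - real k))) \<longlonglongrightarrow> 0"
proof (rule tendsto_sandwich)
  have "(\<Sum>k<K. 1 / (real (Suc k) * (real K - real k))) \<le> 4 / sqrt (real (Suc K))" for K
  proof -
    have "(\<Sum>k<K. 1 / (real (Suc k) * (real K - real k))) =
       (\<Sum>k<K. (1 / real (Suc k) + 1 / (real K - real k)) / real (Suc K))"
    proof (rule sum.cong [OF refl])
      fix k assume "k \<in> {..<K}"
      then have "real (Suc k) > 0" "real K - real k > 0" "real (Suc K) = real (Suc k) + (real K - real k)"
        by auto
      then show "1 / (real (Suc k) * (real K - real k)) = (1 / real (Suc k) + 1 / (real K - real k)) / real (Suc K)"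
        by (simp only:) (simp add: divide_simps del: of_nat_Suc)
    qed
    also have "\<dots> = ((\<Sum>k<K. 1 / real (Suc k)) + (\<Sum>k<K. 1 / (real K - real k))) / real (Suc K)"
      by (simp add: sum_divide_distrib [symmetric] sum.distrib)
    also have "(\<Sum>k<K. 1 / (real K - real k)) = (\<Sum>k<K. 1 / (real (Suc k)))"
      by (subst sum.nat_diff_reindex [symmetric]) (auto intro!: sum.cong simp: of_nat_diff)
    also have "((\<Sum>k<K. 1 / real (Suc k)) + (\<Sum>k<K. 1 / (real (Suc k)))) / real (Suc K)
        \<le> (2 * sqrt (real (Suc K)) + 2 * sqrt (real (Suc K))) / real (Suc K)"
    proof -
      have "(\<Sum>k<K. 1 / real (Suc k)) \<le> 2 * sqrt (real (Suc K))"
        using harm_le_sqrt[of K] real_sqrt_le_mono[of "real K" "real (Suc K)"] by linarith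
      then show ?thesis by (intro divide_right_mono add_mono) auto
    qed
    also have "\<dots> = 4 / sqrt (real (Suc K))"
      using real_sqrt_mult_self[of "real (Suc K)"] by (simp add: field_simps)
    finally show ?thesis .
  qed
  then show "\<forall>\<^sub>F K in sequentially. (\<Sum>k<K. 1 / (real (Suc k) * (real K - real k))) \<le> 4 / sqrt (real (Suc K))"
    by simp
  show "\<forall>\<^sub>F K in sequentially. 0 \<le> (\<Sum>k<K. 1 / (real (Suc k) * (real K - real k)))"
    by (auto intro!: always_eventually sum_nonneg)
  show "(\<lambda>K. 4 / sqrt (real (Suc K))) \<longlonglongrightarrow> 0"
    by (intro tendsto_divide_0[OF tendsto_const] filterlim_at_top_imp_at_infinity
        filterlim_compose[OF sqrt_at_top] filterlim_compose[OF filterlim_real_sequentially] filterlim_Suc)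
qed simp

section \<open>The symmetric series over k for a fixed column\<close>

text \<open>With the central term restored, the symmetric partial sums \<open>S z\<close> are
  quasi-periodic in the limit: \<open>z + 1\<close> in place of \<open>z\<close> produces a factor
  \<open>c\<close>. This reduces the claim to \<open>z = y\<close>, where the two halves are the
  Lerch values that make up Theta, or together the cotangent series.\<close>

lemma Lerch_Theta_sums:
  assumes c: "c \<in> {1, - 1}" and j: "j \<ge> 1" and y: "0 < y" "y < 1"
  shows "(\<lambda>k. c ^ Suc k * (1 / (real l + y - real (Suc k)) ^ j + 1 / (real l + y + real (Suc k)) ^ j)) sums
    (c ^ l * Lerch_Theta c j y 1 - 1 / (real l + y) ^ j)"
proof -
  define S where "S z K = 1 / z ^ j + (\<Sum>k<K. c ^ Suc k * (1 / (z - real (Suc k)) ^ j + 1 / (z + real (Suc k)) ^ j))"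
    for z :: real and K
  have cc: "c * c = 1" using c by auto
  then have cc': "c * (c * x) = x" for x by (simp flip: mult.assoc)
  \<comment> \<open>The two windows of summation overlap except for one term at each end;
    \<open>inv0\<close> makes these end terms vanish.\<close>
  have shift: "S (z + 1) K = c * (S z K + c ^ Suc K / (z + real (Suc K)) ^ j - c ^ K / (z - real K) ^ j)" for z K
  proof (induction K)
    case 0
    then show ?case by (simp add: S_def cc cc' algebra_simps)
  next
    case (Suc K)
    have "S (z + 1) (Suc K) = S (z + 1) K + c ^ Suc K * (1 / (z - real K) ^ j + 1 / (z + real (Suc (Suc K))) ^ j)"
      by (simp add: S_def algebra_simps)
    moreover have "S z (Suc K) = S z K + c ^ Suc K * (1 / (z - real (Suc K)) ^ j + 1 / (z + real (Suc K)) ^ j)"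
      by (simp add: S_def)
    ultimately show ?case unfolding Suc
      by (simp add: algebra_simps add_divide_distrib cc')
  qed
  have inv0: "(\<lambda>K. c ^ K / (x + e * real K) ^ j) \<longlonglongrightarrow> 0" if e: "e \<in> {1, - 1}" for x e
  proof (rule Lim_null_comparison)
    have "filterlim (\<lambda>K. e * x + real K) at_infinity sequentially"
      by (intro filterlim_at_top_imp_at_infinity
          filterlim_tendsto_add_at_top[OF tendsto_const] filterlim_real_sequentially)
    then have "(\<lambda>K. 1 / (e * x + real K)) \<longlonglongrightarrow> 0"
      by (intro tendsto_divide_0[OF tendsto_const])
    then have "(\<lambda>K. \<bar>1 / (e * x + real K)\<bar> ^ j) \<longlonglongrightarrow> \<bar>0\<bar> ^ j" by (intro tendsto_intros)
    then show "(\<lambda>K. \<bar>1 / (e * x + real K)\<bar> ^ j) \<longlonglongrightarrow> 0" using j by (simp add: power_0_left)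
    have "norm (c ^ K / (x + e * real K) ^ j) = \<bar>1 / (e * x + real K)\<bar> ^ j" for K
    proof -
      have "\<bar>x + e * real K\<bar> = \<bar>e * x + real K\<bar>" using e by auto
      then show ?thesis
        using abs_pm1_power[OF c, of K] by (simp add: power_abs power_divide abs_divide)
    qed
    then show "\<forall>\<^sub>F K in sequentially. norm (c ^ K / (x + e * real K) ^ j) \<le> \<bar>1 / (e * x + real K)\<bar> ^ j"
      by simp
  qed
  have base: "S y \<longlonglongrightarrow> Lerch_Theta c j y 1"
  proof (cases "c = 1 \<and> j = 1")
    case True
    have cot: "(\<lambda>K. \<Sum>k<K. 1 / (real k + y) - 1 / (real k + (1 - y))) \<longlonglongrightarrow> pi * cot (pi * y)"
      using sums_cot_partial_fractions[OF y] by (simp add: sums_def)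
    \<comment> \<open>The window contains the bases \<open>y + 0\<close> to \<open>y + K\<close>,
      one more than the sum over \<open>k < K\<close> covers; the surplus term tends to 0.\<close>
    have "S y K = (\<Sum>k<K. 1 / (real k + y) - 1 / (real k + (1 - y))) + c ^ K / (y + 1 * real K) ^ j" (is "_ = ?R K") for K
    proof (induction K)
      case (Suc K)
      have "y - real (Suc K) = - (real K + (1 - y))" by simp
      then have "1 / (y - real (Suc K)) = - (1 / (real K + (1 - y)))" by (simp only: divide_minus_right)
      then show ?case using Suc True by (simp add: S_def add_ac)
    qed (use True in \<open>simp add: S_def\<close>)
    then have "S y = ?R" by blast
    moreover have "(\<lambda>K. (\<Sum>k<K. 1 / (real k + y) - 1 / (real k + (1 - y))) + c ^ K / (y + 1 * real K) ^ j)
        \<longlonglongrightarrow> pi * cot (pi * y) + 0"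
      by (intro tendsto_add cot inv0) simp
    ultimately show ?thesis using True by (simp add: Lerch_Theta_def)
  next
    case False
    have 1: "(\<lambda>K. \<Sum>k<K. c ^ k / (real k + y) ^ j) \<longlonglongrightarrow> Lerch_Phi c j y"
      using Lerch_Phi_sums[of c j y] c j y False by (auto simp: sums_def)
    have 2: "(\<lambda>K. \<Sum>k<K. c ^ k / (real k + (1 - y)) ^ j) \<longlonglongrightarrow> Lerch_Phi c j (1 - y)"
      using Lerch_Phi_sums[of c j "1 - y"] c j y False by (auto simp: sums_def)
    have "S y K = (\<Sum>k<K. c ^ k / (real k + y) ^ j) + c * (- 1) ^ j * (\<Sum>k<K. c ^ k / (real k + (1 - y)) ^ j)
       + c ^ K / (y + 1 * real K) ^ j" (is "_ = ?R K") for K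
    proof (induction K)
      case (Suc K)
      have "y - real (Suc K) = (- 1) * (real K + (1 - y))" by simp
      then have "(y - real (Suc K)) ^ j = (- 1) ^ j * (real K + (1 - y)) ^ j"
        by (simp only: power_mult_distrib)
      then have "1 / (y - real (Suc K)) ^ j = (- 1) ^ j * (1 / (real K + (1 - y)) ^ j)"
        by (cases "even j") simp_all
      moreover have "S y (Suc K) = S y K + c ^ Suc K * (1 / (y - real (Suc K)) ^ j + 1 / (y + real (Suc K)) ^ j)"
        by (simp add: S_def)
      ultimately have "S y (Suc K) = S y K +
          c ^ Suc K * ((- 1) ^ j * (1 / (real K + (1 - y)) ^ j) + 1 / (y + real (Suc K)) ^ j)"
        by (simp only:)
      then show ?case unfolding Suc by (simp add: algebra_simps)
    qed (simp add: S_def)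
    then have "S y = ?R" by blast
    moreover have "(\<lambda>K. (\<Sum>k<K. c ^ k / (real k + y) ^ j) + c * (- 1) ^ j * (\<Sum>k<K. c ^ k / (real k + (1 - y)) ^ j)
       + c ^ K / (y + 1 * real K) ^ j) \<longlonglongrightarrow> Lerch_Phi c j y + c * (- 1) ^ j * Lerch_Phi c j (1 - y) + 0"
      by (intro tendsto_add tendsto_mult tendsto_const 1 2 inv0) simp
    ultimately have "S y \<longlonglongrightarrow> Lerch_Phi c j y + c * (- 1) ^ j * Lerch_Phi c j (1 - y) + 0"
      by (simp only:)
    then show ?thesis unfolding Lerch_Theta_def if_not_P[OF False] by simp
  qed
  have "S (real l + y) \<longlonglongrightarrow> c ^ l * Lerch_Theta c j y 1"
  proof (induction l)
    case (Suc l)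
    have z: "real (Suc l) + y = real l + y + 1" by simp
    have 1: "(\<lambda>K. c ^ Suc K / (real l + y + real (Suc K)) ^ j) \<longlonglongrightarrow> 0"
      using LIMSEQ_Suc[OF inv0[of 1 "real l + y"]] by simp
    have 2: "(\<lambda>K. c ^ K / (real l + y - real K) ^ j) \<longlonglongrightarrow> 0"
      using inv0[of "- 1" "real l + y"] by simp
    have "(\<lambda>K. c * (S (real l + y) K + c ^ Suc K / (real l + y + real (Suc K)) ^ j - c ^ K / (real l + y - real K) ^ j))
        \<longlonglongrightarrow> c * (c ^ l * Lerch_Theta c j y 1 + 0 - 0)"
      by (intro tendsto_intros Suc 1 2)
    then show ?case unfolding z shift[abs_def, symmetric] by (simp add: mult.assoc)
  qed (use base in simp)
  then have "(\<lambda>K. S (real l + y) K - 1 / (real l + y) ^ j) \<longlonglongrightarrow> c ^ l * Lerch_Theta c j y 1 - 1 / (real l + y) ^ j"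
    by (intro tendsto_diff tendsto_const)
  then show ?thesis by (simp add: S_def sums_def)
qed

text \<open>Odd powers cancel between \<open>k\<close> and \<open>- k\<close> before any convergence
  is at stake, so the divergent case \<open>c = 1\<close>, \<open>i = 1\<close> never arises and
  only even orders survive.\<close>

lemma Lerch_Phi_symmetric_sums:
  assumes c: "c \<in> {1, - 1}" and i: "i \<ge> 1"
  shows "(\<lambda>k. c ^ Suc k * (1 / real (Suc k) ^ i + 1 / (- real (Suc k)) ^ i)) sums
    (if even i then 2 * c * Lerch_Phi c i 1 else 0)"
proof (cases "even i")
  case True
  then have "i \<noteq> 1" by auto
  then have "(\<lambda>k. 2 * c * (c ^ k / (real k + 1) ^ i)) sums (2 * c * Lerch_Phi c i 1)"
    using i by (intro sums_mult Lerch_Phi_sums c) auto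
  moreover have "2 * c * (c ^ k / (real k + 1) ^ i) =
      c ^ Suc k * (1 / real (Suc k) ^ i + 1 / (- real (Suc k)) ^ i)" for k
    unfolding power_minus_even[OF True] by (simp add: add.commute)
  ultimately show ?thesis using True by (simp only: if_True)
next
  case False
  then have "(- real (Suc k)) ^ i = - (real (Suc k) ^ i)" for k by (rule power_minus_odd)
  then show ?thesis using False by (simp del: of_nat_Suc)
qed

lemma sum_even_atMost_half:
  fixes q :: nat
  shows "(\<Sum>i=1..q. if even i then f i else 0) = (\<Sum>k=1..q div 2. f (2 * k) :: 'a::comm_monoid_add)"
proof -
  have "(\<Sum>i=1..q. if even i then f i else 0) = (\<Sum>i\<in>{i \<in> {1..q}. even i}. f i)"
    by (rule sum.inter_filter [symmetric]) simp
  also have "\<dots> = (\<Sum>k=1..q div 2. f (2 * k))"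
    by (rule sum.reindex_bij_witness[of _ "\<lambda>k. 2 * k" "\<lambda>i. i div 2"]) auto
  finally show ?thesis .
qed

text \<open>Gathers the corrections \<open>- 1 / z ^ j\<close> of \<open>Lerch_Theta_sums\<close>
  into a single multiple of \<open>1 / z ^ (p + q)\<close>, which becomes the term
  \<open>k = 0\<close> of the sum of even Lerch values.\<close>

lemma sum_choose_hockey_stick:
  assumes "p \<ge> 1" "q \<ge> 1"
  shows "(\<Sum>j=1..p. (p + q - j - 1) choose (q - 1)) = (p + q - 1) choose (p - 1)"
proof -
  obtain P Q where PQ: "p = Suc P" "q = Suc Q"
    using assms by (metis Suc_le_D One_nat_def)
  have "(\<Sum>j=1..p. (p + q - j - 1) choose (q - 1)) = (\<Sum>j\<le>P. (Q + (P - j)) choose Q)"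
    unfolding PQ
    by (rule sum.reindex_bij_witness[of _ Suc "\<lambda>j. j - 1"]) (auto simp: add.commute)
  also have "\<dots> = (\<Sum>j\<le>P. (Q + j) choose Q)"
    using sum.nat_diff_reindex[of "\<lambda>j. (Q + j) choose Q" "Suc P"]
    by (simp only: lessThan_Suc_atMost diff_Suc_Suc)
  also have "\<dots> = (\<Sum>j\<le>P. (Q + j) choose j)"
    by (intro sum.cong refl) (metis add_diff_cancel_left' binomial_symmetric le_add1)
  also have "\<dots> = Suc (Q + P) choose P" by (rule sum_choose_lower)
  finally show ?thesis by (simp add: PQ add.commute)
qed

text \<open>Expands the series over \<open>k\<close> by partial fractions with \<open>u = \<plusminus> k\<close> and \<open>u + v = z\<close>;
  the value \<open>\<Phi>(c, 0, 1) = - c / 2\<close> accounts for the missing term \<open>k = 0\<close>.\<close>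
lemma kernel_series_sums:
  assumes c: "c \<in> {1, - 1}" and pq: "p \<ge> 1" "q \<ge> 1" and y: "0 < y" "y < 1"
    and z: "z = real l + y"
  shows "(\<lambda>k. c ^ Suc k / real (Suc k) ^ q *
      (1 / (z - real (Suc k)) ^ p + (- 1) ^ q / (z + real (Suc k)) ^ p)) sums
    ((\<Sum>k=0..q div 2. real ((p + q - 2 * k - 1) choose (p - 1)) * (2 * c * Lerch_Phi c (2 * k) 1) / z ^ (p + q - 2 * k))
     + (\<Sum>j=1..p. real ((p + q - j - 1) choose (q - 1)) * (c ^ l * Lerch_Theta c j y 1) / z ^ (p + q - j)))"
proof -
  let ?B = "\<lambda>i. real ((p + q - i - 1) choose (p - 1))"
  let ?C = "\<lambda>j. real ((p + q - j - 1) choose (q - 1))"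
  have z0: "z > 0" using y z by simp
  have nz: "z - real (Suc k) \<noteq> 0" for k
  proof
    assume "z - real (Suc k) = 0"
    then have "real l < real (Suc k)" "real (Suc k) < real (Suc l)" using y z by linarith+
    then show False by simp
  qed
  have term_eq: "c ^ Suc k / real (Suc k) ^ q * (1 / (z - real (Suc k)) ^ p + (- 1) ^ q / (z + real (Suc k)) ^ p) =
    (\<Sum>i=1..q. ?B i / z ^ (p + q - i) * (c ^ Suc k * (1 / real (Suc k) ^ i + 1 / (- real (Suc k)) ^ i))) +
    (\<Sum>j=1..p. ?C j / z ^ (p + q - j) * (c ^ Suc k * (1 / (z - real (Suc k)) ^ j + 1 / (z + real (Suc k)) ^ j)))"
    (is "?L = ?R") for k
  proof -
    let ?x = "real (Suc k)"
    have 1: "1 / (?x ^ q * (z - ?x) ^ p) =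
      (\<Sum>i=1..q. ?B i / (?x ^ i * z ^ (p + q - i))) + (\<Sum>j=1..p. ?C j / ((z - ?x) ^ j * z ^ (p + q - j)))"
      using partial_fractions[of ?x "z - ?x" p q] z0 nz[of k] pq by simp
    have 2: "1 / ((- ?x) ^ q * (z + ?x) ^ p) =
      (\<Sum>i=1..q. ?B i / ((- ?x) ^ i * z ^ (p + q - i))) + (\<Sum>j=1..p. ?C j / ((z + ?x) ^ j * z ^ (p + q - j)))"
      using partial_fractions[of "- ?x" "z + ?x" p q] z0 pq by simp
    have "(- ?x) ^ q = (- 1) ^ q * ?x ^ q" by (rule power_minus)
    then have "1 / ((- ?x) ^ q * (z + ?x) ^ p) = (- 1) ^ q / (?x ^ q * (z + ?x) ^ p)"
      by (cases "even q") simp_all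
    then have "?L = c ^ Suc k * (1 / (?x ^ q * (z - ?x) ^ p) + 1 / ((- ?x) ^ q * (z + ?x) ^ p))"
      by (simp add: algebra_simps del: of_nat_Suc power_Suc)
    also have "\<dots> = ?R" unfolding 1 2
      by (simp add: sum_distrib_left sum.distrib [symmetric] distrib_left del: of_nat_Suc power_Suc)
        (simp add: algebra_simps sum.distrib del: of_nat_Suc power_Suc)
    finally show ?thesis .
  qed
  have "(\<lambda>k. ?L k) sums
    ((\<Sum>i=1..q. ?B i / z ^ (p + q - i) * (if even i then 2 * c * Lerch_Phi c i 1 else 0)) +
     (\<Sum>j=1..p. ?C j / z ^ (p + q - j) * (c ^ l * Lerch_Theta c j y 1 - 1 / z ^ j)))"
    unfolding term_eq unfolding z
    by (intro sums_add sums_sum sums_mult Lerch_Phi_symmetric_sums Lerch_Theta_sums c y) auto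
  also have "(\<Sum>j=1..p. ?C j / z ^ (p + q - j) * (c ^ l * Lerch_Theta c j y 1 - 1 / z ^ j)) =
    (\<Sum>j=1..p. ?C j * (c ^ l * Lerch_Theta c j y 1) / z ^ (p + q - j)) - (\<Sum>j=1..p. ?C j) / z ^ (p + q)"
  proof -
    have "?C j / z ^ (p + q - j) * (t - 1 / z ^ j) = ?C j * t / z ^ (p + q - j) - ?C j / z ^ (p + q)"
      if "j \<in> {1..p}" for j t
    proof -
      have "z ^ (p + q - j) * z ^ j = z ^ (p + q)" using that by (simp flip: power_add)
      then show ?thesis by (simp add: right_diff_distrib)
    qed
    then show ?thesis by (simp add: sum_subtractf sum_divide_distrib)
  qed
  also have "(\<Sum>j=1..p. ?C j) = ?B 0"
    using sum_choose_hockey_stick[OF pq] by (simp flip: of_nat_sum)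
  also have "(\<Sum>i=1..q. ?B i / z ^ (p + q - i) * (if even i then 2 * c * Lerch_Phi c i 1 else 0)) =
      (\<Sum>i=1..q. if even i then ?B i * (2 * c * Lerch_Phi c i 1) / z ^ (p + q - i) else 0)"
    by (intro sum.cong) auto
  also have "\<dots> = (\<Sum>k=1..q div 2. ?B (2 * k) * (2 * c * Lerch_Phi c (2 * k) 1) / z ^ (p + q - 2 * k))"
    by (rule sum_even_atMost_half)
  also have "\<dots> = (\<Sum>k=0..q div 2. ?B (2 * k) * (2 * c * Lerch_Phi c (2 * k) 1) / z ^ (p + q - 2 * k))
      + ?B 0 / z ^ (p + q)"
  proof -
    have "2 * c * Lerch_Phi c 0 1 = - 1" using c by (auto simp: Lerch_Phi_def)
    then show ?thesis by (simp add: sum.atLeast_Suc_atMost[of 0])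
  qed
  finally show ?thesis by simp
qed

section \<open>Row and column sums over the truncated lattice\<close>

text \<open>The sum of the terms of index \<open>k\<close> and \<open>- k\<close> of the double series above, divided by \<open>b ^ m * c ^ k / k ^ q\<close>.\<close>
definition lattice_kernel :: "nat \<Rightarrow> nat \<Rightarrow> nat \<Rightarrow> nat \<Rightarrow> nat \<Rightarrow> real" where
  "lattice_kernel p q n m k =
     1 / (real m + (1 / 2 - real (n * k))) ^ p + (- 1) ^ q / (real m + (1 / 2 + real (n * k))) ^ p"

lemma sum_lattice_kernel:
  "(\<Sum>m<M. b ^ m * lattice_kernel p q n m k) =
    (\<Sum>m<M. b ^ m / (real m + (1 / 2 - real (n * k))) ^ p) +
    (- 1) ^ q * (\<Sum>m<M. b ^ m / (real m + (1 / 2 + real (n * k))) ^ p)"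
  unfolding lattice_kernel_def sum_distrib_left sum.distrib [symmetric]
  by (intro sum.cong refl) (simp add: distrib_left del: of_nat_mult)

text \<open>The limits of the two shifted series combine to the bracket. The error consists of two
  tails, and the one with shift \<open>- n * k\<close> has the smaller denominator.\<close>

lemma lattice_kernel_partial_sum_limit:
  assumes b: "b \<in> {1, - 1}" and p: "p \<ge> 1" "b = 1 \<Longrightarrow> p \<noteq> 1"
    and bpq: "b = (- 1) ^ (p + q - 1)" and M: "n * k \<le> M"
  shows "\<bar>(\<Sum>m<M. b ^ m * lattice_kernel p q n m k) - b ^ (n * k) *
      ((1 + (- 1) ^ q) * Lerch_Phi b p (1 / 2) - 2 * (- 1) ^ q * 2 ^ p * odd_harmonic p b (n * k))\<bar>
    \<le> 2 * (3 * 2 ^ p) / (real M + (1 / 2 - real (n * k)))"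
proof -
  define N where "N = n * k"
  define u where "u = b ^ N * (Lerch_Phi b p (1 / 2) + b * (- 1) ^ p * 2 ^ p * odd_harmonic p b N)"
  define v where "v = b ^ N * (Lerch_Phi b p (1 / 2) - 2 ^ p * odd_harmonic p b N)"
  define s where "s = (\<Sum>m<M. b ^ m / (real m + (1 / 2 - real N)) ^ p)"
  define t where "t = (\<Sum>m<M. b ^ m / (real m + (1 / 2 + real N)) ^ p)"
  define D where "D = real M + (1 / 2 - real N)"
  have M': "real M \<ge> real N" using M by (simp add: N_def del: of_nat_mult)
  have D: "D \<ge> 1 / 2" "D \<le> real M + (1 / 2 + real N)" using M' by (simp_all add: D_def)
  \<comment> \<open>Here the choice of \<open>b\<close> enters: the odd harmonic numbers from the
    shifts by \<open>n * k\<close> and \<open>- n * k\<close> get equal signs and add up.\<close>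
  have sgn: "b * (- 1) ^ p = - ((- 1) ^ q)"
  proof -
    obtain p' where "p = Suc p'" using p(1) by (cases p) auto
    then show ?thesis unfolding bpq by (cases "even p'") (simp_all add: power_add)
  qed
  have 1: "\<bar>s - u\<bar> \<le> 3 * 2 ^ p / D"
    unfolding s_def u_def D_def
    by (rule Lerch_tail_bound[OF b p Lerch_Phi_sums_shift(2)[OF b p]]) (use D in \<open>simp_all add: D_def\<close>)
  have "\<bar>t - v\<bar> \<le> 3 * 2 ^ p / (real M + (1 / 2 + real N))"
    unfolding t_def v_def
    by (rule Lerch_tail_bound[OF b p Lerch_Phi_sums_shift(1)[OF b p]]) (use D in simp_all)
  also have "\<dots> \<le> 3 * 2 ^ p / D" using D by (intro divide_left_mono mult_pos_pos) auto
  finally have 2: "\<bar>t - v\<bar> \<le> 3 * 2 ^ p / D" .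
  have "b ^ N * ((1 + (- 1) ^ q) * Lerch_Phi b p (1 / 2) - 2 * (- 1) ^ q * 2 ^ p * odd_harmonic p b N) =
      u + (- 1) ^ q * v"
    unfolding u_def v_def sgn by (simp add: algebra_simps)
  then have "\<bar>(\<Sum>m<M. b ^ m * lattice_kernel p q n m k) - b ^ N * ((1 + (- 1) ^ q) * Lerch_Phi b p (1 / 2)
      - 2 * (- 1) ^ q * 2 ^ p * odd_harmonic p b N)\<bar> = \<bar>(s + (- 1) ^ q * t) - (u + (- 1) ^ q * v)\<bar>"
    by (simp only: sum_lattice_kernel s_def t_def N_def)
  also have "\<dots> \<le> \<bar>s - u\<bar> + \<bar>t - v\<bar>"
    by (cases "even q") auto
  also have "\<dots> \<le> 3 * 2 ^ p / D + 3 * 2 ^ p / D" by (intro add_mono 1 2)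
  also have "\<dots> = 2 * (3 * 2 ^ p) / D" by simp
  finally show ?thesis unfolding N_def D_def .
qed

text \<open>For \<open>M < n * k\<close> every base \<open>m + 1 / 2 - n * k\<close> is negative.
  Reflection moves the block to the positive argument \<open>n * k - M + 1 / 2\<close>, where the
  uniform bound applies.\<close>

lemma lattice_kernel_partial_sum_bound:
  assumes b: "b \<in> {1, - 1}" and p: "p \<ge> 1" "b = 1 \<Longrightarrow> p \<noteq> 1" and M: "M < n * k"
  shows "\<bar>\<Sum>m<M. b ^ m * lattice_kernel p q n m k\<bar> \<le> 2 * (3 * 2 ^ p) / (real (n * k) - real M)"
proof -
  define N where "N = n * k"
  define s where "s = (\<Sum>m<M. b ^ m / (real m + (1 / 2 - real N)) ^ p)"
  define t where "t = (\<Sum>m<M. b ^ m / (real m + (1 / 2 + real N)) ^ p)"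
  define D where "D = real N - real M"
  have "real (Suc M) \<le> real N" using M unfolding N_def by (intro of_nat_mono) simp
  then have D: "D \<ge> 1" by (simp add: D_def)
  have le: "3 * 2 ^ p / x \<le> 3 * 2 ^ p / D" if "D \<le> x" for x
    using D that by (intro divide_left_mono mult_pos_pos) auto
  have "\<bar>b ^ M * b * (- 1) ^ p\<bar> = 1"
    using abs_pm1_power[OF b, of M] abs_pm1_power[OF b, of 1] by (simp add: abs_mult)
  moreover have "s = b ^ M * b * (- 1) ^ p * (\<Sum>i<M. b ^ i / (real i + (1 - real M - (1 / 2 - real N))) ^ p)"
    unfolding s_def by (rule Lerch_partial_sum_reflect[OF b])
  then have "\<bar>s\<bar> = \<bar>b ^ M * b * (- 1) ^ p\<bar> * \<bar>\<Sum>i<M. b ^ i / (real i + (1 - real M - (1 / 2 - real N))) ^ p\<bar>"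
    by (simp only: abs_mult)
  ultimately have "\<bar>s\<bar> = \<bar>\<Sum>i<M. b ^ i / (real i + (1 - real M - (1 / 2 - real N))) ^ p\<bar>"
    by (simp only: mult_1)
  also have "\<dots> \<le> 3 * 2 ^ p / (1 - real M - (1 / 2 - real N))"
    using D by (intro Lerch_partial_sum_bound b p) (auto simp: D_def)
  also have "\<dots> \<le> 3 * 2 ^ p / D" by (rule le) (simp add: D_def)
  finally have 1: "\<bar>s\<bar> \<le> 3 * 2 ^ p / D" .
  have "\<bar>t\<bar> \<le> 3 * 2 ^ p / (1 / 2 + real N)"
    unfolding t_def by (intro Lerch_partial_sum_bound b p) auto
  also have "\<dots> \<le> 3 * 2 ^ p / D" by (rule le) (simp add: D_def)
  finally have 2: "\<bar>t\<bar> \<le> 3 * 2 ^ p / D" .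
  have "\<bar>\<Sum>m<M. b ^ m * lattice_kernel p q n m k\<bar> = \<bar>s + (- 1) ^ q * t\<bar>"
    by (simp only: sum_lattice_kernel s_def t_def N_def)
  also have "\<dots> \<le> \<bar>s\<bar> + \<bar>t\<bar>" by (cases "even q") auto
  also have "\<dots> \<le> 3 * 2 ^ p / D + 3 * 2 ^ p / D" by (intro add_mono 1 2)
  also have "\<dots> = 2 * (3 * 2 ^ p) / D" by simp
  finally show ?thesis unfolding N_def D_def .
qed

lemma pm1_mult_power: "a \<in> {1, - 1 :: real} \<Longrightarrow> b \<in> {1, - 1} \<Longrightarrow> a * b ^ n \<in> {1, - 1}"
  by (cases "even n") auto

text \<open>Each row inside the box is replaced by its full sum. The error, weighted by
  \<open>1 / k ^ q\<close>, is dominated by the harmonic convolution, and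
  \<open>c ^ k * b ^ (n * k) = a ^ k\<close> turns the character \<open>c\<close> into
  \<open>a\<close>.\<close>

lemma truncated_lattice_sum_by_rows:
  assumes a: "a \<in> {1, - 1 :: real}" and b: "b \<in> {1, - 1}" and p: "p \<ge> 1" "b = 1 \<Longrightarrow> p \<noteq> 1"
    and q: "q \<ge> 1" and n: "n \<ge> 1" and bpq: "b = (- 1) ^ (p + q - 1)"
  defines "X \<equiv> \<lambda>k. (1 + (- 1) ^ q) * Lerch_Phi b p (1 / 2) - 2 * (- 1) ^ q * 2 ^ p * odd_harmonic p b (n * k)"
  shows "(\<lambda>K. (\<Sum>k<K. (a * b ^ n) ^ Suc k / real (Suc k) ^ q * (\<Sum>m<n * K. b ^ m * lattice_kernel p q n m (Suc k)))
     - (\<Sum>k<K. a ^ Suc k / real (Suc k) ^ q * X (Suc k))) \<longlonglongrightarrow> 0"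
proof (rule Lim_null_comparison)
  let ?C = "3 * 2 ^ p :: real" and ?c = "a * b ^ n"
  let ?I = "\<lambda>K k. \<Sum>m<n * K. b ^ m * lattice_kernel p q n m (Suc k)"
  show "(\<lambda>K. 4 * ?C * (\<Sum>k<K. 1 / (real (Suc k) * (real K - real k)))) \<longlonglongrightarrow> 0"
    using tendsto_mult_left[OF harmonic_convolution_tendsto_0, of "4 * ?C"] by simp
  have c: "?c \<in> {1, - 1}" using a b by (rule pm1_mult_power)
  have main: "\<bar>?c ^ Suc k / real (Suc k) ^ q * (?I K k - b ^ (n * Suc k) * X (Suc k))\<bar>
      \<le> 4 * ?C * (1 / (real (Suc k) * (real K - real k)))" if k: "k < K" for k K
  proof -
    obtain d where d: "K = Suc k + d" using k by (metis Suc_leI le_Suc_ex)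
    have "real d \<le> real n * real d" using n by (simp add: mult_le_cancel_right1)
    \<comment> \<open>Halving covers the last row \<open>Suc k = K\<close>, where only the summand
      \<open>1 / 2\<close> remains on the right.\<close>
    then have den: "(real K - real k) / 2 \<le> real (n * K) + (1 / 2 - real (n * Suc k))"
      by (simp add: d algebra_simps)
    have pos: "real K - real k > 0" using k by simp
    have "\<bar>?I K k - b ^ (n * Suc k) * X (Suc k)\<bar> \<le> 2 * ?C / (real (n * K) + (1 / 2 - real (n * Suc k)))"
      unfolding X_def by (intro lattice_kernel_partial_sum_limit[OF b p bpq] mult_le_mono2 Suc_leI k)
    also have "\<dots> \<le> 2 * ?C / ((real K - real k) / 2)"
      using den pos by (intro divide_left_mono mult_pos_pos) auto
    finally have 1: "\<bar>?I K k - b ^ (n * Suc k) * X (Suc k)\<bar> \<le> 4 * ?C / (real K - real k)" by simp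
    have "real (Suc k) ^ 1 \<le> real (Suc k) ^ q" using q by (intro power_increasing) auto
    then have "1 / real (Suc k) ^ q \<le> 1 / real (Suc k)" by (intro divide_left_mono) auto
    then have 2: "\<bar>?c ^ Suc k / real (Suc k) ^ q\<bar> \<le> 1 / real (Suc k)"
      unfolding abs_divide abs_pm1_power[OF c] by simp
    have "\<bar>?c ^ Suc k / real (Suc k) ^ q\<bar> * \<bar>?I K k - b ^ (n * Suc k) * X (Suc k)\<bar>
        \<le> (1 / real (Suc k)) * (4 * ?C / (real K - real k))"
      using 1 2 by (intro mult_mono) auto
    then show ?thesis by (simp add: abs_mult)
  qed
  show "\<forall>\<^sub>F K in sequentially. norm ((\<Sum>k<K. ?c ^ Suc k / real (Suc k) ^ q * ?I K k)
     - (\<Sum>k<K. a ^ Suc k / real (Suc k) ^ q * X (Suc k))) \<le> 4 * ?C * (\<Sum>k<K. 1 / (real (Suc k) * (real K - real k)))"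
  proof (rule always_eventually, rule allI)
    fix K
    have "?c ^ Suc k * b ^ (n * Suc k) = a ^ Suc k" for k
    proof -
      have "?c ^ Suc k * b ^ (n * Suc k) = a ^ Suc k * (b ^ (n * Suc k) * b ^ (n * Suc k))"
        by (simp only: power_mult_distrib power_mult mult.assoc)
      then show ?thesis by (simp only: pm1_power_mult_self[OF b] mult_1_right)
    qed
    moreover have "?c ^ Suc k / real (Suc k) ^ q * (b ^ (n * Suc k) * X (Suc k)) =
        (?c ^ Suc k * b ^ (n * Suc k)) / real (Suc k) ^ q * X (Suc k)" for k
      by (simp only: times_divide_eq_left mult.assoc)
    ultimately have eq: "?c ^ Suc k / real (Suc k) ^ q * (b ^ (n * Suc k) * X (Suc k)) =
        a ^ Suc k / real (Suc k) ^ q * X (Suc k)" for k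
      by (simp only:)
    have "norm (\<Sum>k<K. ?c ^ Suc k / real (Suc k) ^ q * (?I K k - b ^ (n * Suc k) * X (Suc k)))
        \<le> (\<Sum>k<K. 4 * ?C * (1 / (real (Suc k) * (real K - real k))))"
      by (rule sum_norm_le) (unfold real_norm_def, rule main, simp)
    then show "norm ((\<Sum>k<K. ?c ^ Suc k / real (Suc k) ^ q * ?I K k)
       - (\<Sum>k<K. a ^ Suc k / real (Suc k) ^ q * X (Suc k))) \<le> 4 * ?C * (\<Sum>k<K. 1 / (real (Suc k) * (real K - real k)))"
      unfolding right_diff_distrib eq sum_subtractf sum_distrib_left[of "4 * ?C"] .
  qed
qed

text \<open>Finitely many full columns differ from the box by the rows with \<open>k > K\<close>.
  There all bases with shift \<open>- n * k\<close> are negative, so each truncated row is small by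
  \<open>lattice_kernel_partial_sum_bound\<close>.\<close>

lemma truncated_lattice_sum_by_columns:
  assumes b: "b \<in> {1, - 1}" and p: "p \<ge> 1" "b = 1 \<Longrightarrow> p \<noteq> 1"
    and q: "q \<ge> 1" and n: "n \<ge> 1" and c: "c \<in> {1, - 1 :: real}"
    and G: "\<And>m. (\<lambda>k. c ^ Suc k / real (Suc k) ^ q * lattice_kernel p q n m (Suc k)) sums G m"
  shows "(\<lambda>K. (\<Sum>m<n * K. b ^ m * G m)
     - (\<Sum>k<K. c ^ Suc k / real (Suc k) ^ q * (\<Sum>m<n * K. b ^ m * lattice_kernel p q n m (Suc k)))) \<longlonglongrightarrow> 0"
proof (rule Lim_null_comparison)
  let ?C = "3 * 2 ^ p :: real"
  \<comment> \<open>Row \<open>K + j\<close> contributes at most a constant times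
    \<open>1 / ((K + j) * j)\<close>. By the inequality of the means \<open>K + j\<close> exceeds
    \<open>sqrt K * sqrt j\<close>, which splits off the null factor \<open>1 / sqrt K\<close> and
    leaves a summable series.\<close>
  let ?t = "\<lambda>j. 1 / (real (Suc j) * sqrt (real (Suc j)))"
  have "summable (\<lambda>j. real j powr (- 3 / 2))" by (simp add: summable_real_powr_iff)
  then have "summable (\<lambda>j. real (Suc j) powr (- 3 / 2))"
    by (subst summable_Suc_iff[where f = "\<lambda>j. real j powr (- 3 / 2)"])
  moreover have "real (Suc j) powr (- 3 / 2) = ?t j" for j
  proof -
    have "real (Suc j) powr (- 3 / 2) = 1 / real (Suc j) powr (1 + 1 / 2)"
      by (subst powr_minus_divide [symmetric]) simp
    then show ?thesis by (simp only: powr_add powr_half_sqrt of_nat_0_le_iff) (simp del: of_nat_Suc)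
  qed
  ultimately have T: "summable ?t" by (simp only:)
  have "(\<lambda>K. 2 * ?C / sqrt (real K) * suminf ?t) \<longlonglongrightarrow> 0 * suminf ?t"
    by (intro tendsto_mult tendsto_const tendsto_divide_0[OF tendsto_const] filterlim_at_top_imp_at_infinity
        filterlim_compose[OF sqrt_at_top] filterlim_real_sequentially)
  then show "(\<lambda>K. 2 * ?C / sqrt (real K) * suminf ?t) \<longlonglongrightarrow> 0" by simp
  show "\<forall>\<^sub>F K in sequentially. norm ((\<Sum>m<n * K. b ^ m * G m)
     - (\<Sum>k<K. c ^ Suc k / real (Suc k) ^ q * (\<Sum>m<n * K. b ^ m * lattice_kernel p q n m (Suc k))))
     \<le> 2 * ?C / sqrt (real K) * suminf ?t"
    using eventually_gt_at_top[of 0]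
  proof eventually_elim
    case (elim K)
    let ?g = "\<lambda>k. c ^ Suc k / real (Suc k) ^ q * (\<Sum>m<n * K. b ^ m * lattice_kernel p q n m (Suc k))"
    have "(\<lambda>k. \<Sum>m<n * K. b ^ m * (c ^ Suc k / real (Suc k) ^ q * lattice_kernel p q n m (Suc k)))
        sums (\<Sum>m<n * K. b ^ m * G m)"
      by (intro sums_sum sums_mult G)
    moreover have "(\<Sum>m<n * K. b ^ m * (c ^ Suc k / real (Suc k) ^ q * lattice_kernel p q n m (Suc k))) = ?g k" for k
      by (simp only: sum_distrib_left mult.left_commute)
    ultimately have "?g sums (\<Sum>m<n * K. b ^ m * G m)" by (simp only:)
    then have "(\<lambda>j. ?g (j + K)) sums ((\<Sum>m<n * K. b ^ m * G m) - (\<Sum>k<K. ?g k))"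
      by (rule sums_split_initial_segment)
    then have eq: "(\<Sum>m<n * K. b ^ m * G m) - (\<Sum>k<K. ?g k) = (\<Sum>j. ?g (j + K))"
      by (rule sums_unique)
    have "norm (?g (j + K)) \<le> 2 * ?C / sqrt (real K) * ?t j" for j
    proof -
      define k where "k = Suc (j + K)"
      have kj: "real k = real (Suc j) + real K" by (simp add: k_def)
      have k0: "real k > 0" by (simp add: k_def)
      have "real (Suc j) \<le> real n * real (Suc j)" using n by (simp add: mult_le_cancel_right1 del: of_nat_Suc)
      then have den: "real (Suc j) \<le> real (n * k) - real (n * K)"
        by (simp add: kj distrib_left del: of_nat_Suc)
      have pos: "0 < real (n * k) - real (n * K)" using den by linarith
      then have "n * K < n * k" by (simp only: diff_gt_0_iff_gt of_nat_less_iff)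
      then have "\<bar>\<Sum>m<n * K. b ^ m * lattice_kernel p q n m k\<bar> \<le> 2 * ?C / (real (n * k) - real (n * K))"
        by (intro lattice_kernel_partial_sum_bound b p)
      also have "\<dots> \<le> 2 * ?C / real (Suc j)"
        using den by (intro divide_left_mono mult_pos_pos pos) auto
      finally have 1: "\<bar>\<Sum>m<n * K. b ^ m * lattice_kernel p q n m k\<bar> \<le> 2 * ?C / real (Suc j)" .
      have "real k ^ 1 \<le> real k ^ q" using q by (intro power_increasing) (auto simp: k_def)
      then have "1 / real k ^ q \<le> 1 / real k" using k0 by (intro divide_left_mono) auto
      also have "\<dots> \<le> 1 / (sqrt (real K) * sqrt (real (Suc j)))"
      proof -
        have "2 * sqrt (real K) * sqrt (real (Suc j)) \<le> real K + real (Suc j)"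
          using arith_geo_mean_sqrt[of "real K" "real (Suc j)"] by (simp add: real_sqrt_mult)
        moreover have "0 \<le> sqrt (real K) * sqrt (real (Suc j))" by simp
        ultimately have "sqrt (real K) * sqrt (real (Suc j)) \<le> real k" unfolding kj by linarith
        then show ?thesis using k0 elim by (intro divide_left_mono mult_pos_pos) auto
      qed
      finally have 2: "\<bar>c ^ k / real k ^ q\<bar> \<le> 1 / (sqrt (real K) * sqrt (real (Suc j)))"
        unfolding abs_divide abs_pm1_power[OF c] by simp
      have "\<bar>c ^ k / real k ^ q\<bar> * \<bar>\<Sum>m<n * K. b ^ m * lattice_kernel p q n m k\<bar>
          \<le> 1 / (sqrt (real K) * sqrt (real (Suc j))) * (2 * ?C / real (Suc j))"
        using 1 2 by (intro mult_mono) auto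
      also have "\<dots> = 2 * ?C / sqrt (real K) * ?t j" by (simp add: mult_ac)
      finally show ?thesis by (simp only: k_def abs_mult real_norm_def)
    qed
    then have "norm (\<Sum>j. ?g (j + K)) \<le> (\<Sum>j. 2 * ?C / sqrt (real K) * ?t j)"
      by (intro norm_suminf_le summable_mult T)
    also have "\<dots> = 2 * ?C / sqrt (real K) * suminf ?t"
      by (intro suminf_mult T)
    finally show ?case unfolding eq .
  qed
qed

section \<open>Limits of the column sums by residues modulo n\<close>

lemma Lerch_Theta_rescale:
  "r \<noteq> 0 \<Longrightarrow> Lerch_Theta c k s r = Lerch_Theta c k (s / r) 1"
  by (simp add: Lerch_Theta_def diff_divide_distrib)

text \<open>The two Lerch values change places, and \<open>c * (- 1) ^ k\<close> squares to 1. The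
  cotangent obeys the same rule because \<open>cot (pi - x) = - cot x\<close>.\<close>

lemma Lerch_Theta_reflect:
  assumes c: "c \<in> {1, - 1}"
  shows "Lerch_Theta c k (1 - y) 1 = c * (- 1) ^ k * Lerch_Theta c k y 1"
proof (cases "c = 1 \<and> k = 1")
  case True
  have "pi * (1 - y) = pi - pi * y" by (simp add: algebra_simps)
  then have "cot (pi * (1 - y)) = - cot (pi * y)" by (simp add: cot_def)
  then show ?thesis using True by (simp add: Lerch_Theta_def)
next
  case False
  have "c * (- 1) ^ k * (c * (- 1) ^ k) = 1"
    using c by (cases "even k") auto
  then have "c * (- 1) ^ k * (c * (- 1) ^ k * x) = x" for x
    by (simp flip: mult.assoc)
  then show ?thesis
    unfolding Lerch_Theta_def if_not_P[OF False] by (simp add: distrib_left)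
qed

lemma lattice_kernel_rescale:
  assumes n: "n \<ge> 1"
  shows "lattice_kernel p q n m k =
    (1 / ((real m + 1 / 2) / real n - real k) ^ p + (- 1) ^ q / ((real m + 1 / 2) / real n + real k) ^ p) / real n ^ p"
proof -
  have "real m + (1 / 2 - real (n * k)) = real n * ((real m + 1 / 2) / real n - real k)"
    and "real m + (1 / 2 + real (n * k)) = real n * ((real m + 1 / 2) / real n + real k)"
    using n by (simp_all add: field_simps)
  then show ?thesis
    unfolding lattice_kernel_def by (simp add: power_mult_distrib add_divide_distrib mult.commute)
qed

lemma zeta_part_tendsto:
  assumes b: "b \<in> {1, - 1}" and s: "s \<ge> 1" "b = 1 \<Longrightarrow> s \<noteq> 1" and n: "n \<ge> 1"
  shows "(\<lambda>K. \<Sum>m<n * K. b ^ m * (x / ((real m + 1 / 2) / real n) ^ s)) \<longlonglongrightarrow>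
    x * real n ^ s * Lerch_Phi b s (1 / 2)"
proof -
  have "(\<lambda>N. \<Sum>m<N. b ^ m / (real m + 1 / 2) ^ s) \<longlonglongrightarrow> Lerch_Phi b s (1 / 2)"
    using Lerch_Phi_sums[OF b s] by (simp add: sums_def)
  moreover have "filterlim (\<lambda>K. n * K) at_top sequentially"
    using n by (intro mult_nat_left_at_top) simp
  ultimately have "(\<lambda>K. \<Sum>m<n * K. b ^ m / (real m + 1 / 2) ^ s) \<longlonglongrightarrow> Lerch_Phi b s (1 / 2)"
    by (rule filterlim_compose)
  then have "(\<lambda>K. x * real n ^ s * (\<Sum>m<n * K. b ^ m / (real m + 1 / 2) ^ s)) \<longlonglongrightarrow>
      x * real n ^ s * Lerch_Phi b s (1 / 2)"
    by (rule tendsto_mult_left)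
  moreover have "b ^ m * (x / ((real m + 1 / 2) / real n) ^ s) = x * real n ^ s * (b ^ m / (real m + 1 / 2) ^ s)" for m
    by (simp add: power_divide)
  ultimately show ?thesis by (simp only: sum_distrib_left)
qed

text \<open>The range \<open>m < n * K\<close> is \<open>K\<close> full blocks. With
  \<open>m = r + l * n\<close> the factors \<open>b ^ (l * n)\<close> square away, leaving
  \<open>b ^ r * a ^ l\<close>, so each residue \<open>r\<close> carries a Lerch series in
  \<open>a\<close>.\<close>

lemma theta_part_tendsto:
  assumes a: "a \<in> {1, - 1}" and b: "b \<in> {1, - 1}" and s: "s \<ge> 1" "a = 1 \<Longrightarrow> s \<noteq> 1" and n: "n \<ge> 1"
  shows "(\<lambda>K. \<Sum>m<n * K. b ^ m * (x * ((a * b ^ n) ^ (m div n) * \<theta> (m mod n)) / ((real m + 1 / 2) / real n) ^ s))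
    \<longlonglongrightarrow> x * (\<Sum>r<n. b ^ r * \<theta> r * Lerch_Phi a s ((real r + 1 / 2) / real n))"
proof -
  let ?f = "\<lambda>m. b ^ m * (x * ((a * b ^ n) ^ (m div n) * \<theta> (m mod n)) / ((real m + 1 / 2) / real n) ^ s)"
  let ?h = "\<lambda>r l. a ^ l / (real l + (real r + 1 / 2) / real n) ^ s"
  have f_eq: "?f (r + l * n) = x * (b ^ r * \<theta> r * ?h r l)" if "r < n" for r l
  proof -
    have "b ^ (r + l * n) * (a * b ^ n) ^ l = b ^ r * a ^ l * (b ^ (l * n) * b ^ (l * n))"
      by (simp add: power_add power_mult_distrib mult_ac flip: power_mult)
    also have "\<dots> = b ^ r * a ^ l" unfolding pm1_power_mult_self[OF b] by simp
    finally have 1: "b ^ (r + l * n) * (a * b ^ n) ^ l = b ^ r * a ^ l" .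
    have 2: "(real (r + l * n) + 1 / 2) / real n = real l + (real r + 1 / 2) / real n"
      using n by (simp add: field_simps)
    have "(r + l * n) div n = l" "(r + l * n) mod n = r" using that by simp_all
    then have "?f (r + l * n) = b ^ (r + l * n) * (x * ((a * b ^ n) ^ l * \<theta> r) / (real l + (real r + 1 / 2) / real n) ^ s)"
      by (simp only: 2)
    also have "\<dots> = (b ^ (r + l * n) * (a * b ^ n) ^ l) * (x * \<theta> r / (real l + (real r + 1 / 2) / real n) ^ s)"
      by (simp only: times_divide_eq_right mult_ac)
    also have "\<dots> = x * (b ^ r * \<theta> r * ?h r l)" unfolding 1 by simp
    finally show ?thesis .
  qed
  have block: "sum f {l * n..<l * n + n} = (\<Sum>r<n. f (r + l * n))" for f :: "nat \<Rightarrow> real" and l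
    by (subst sum.atLeastLessThan_shift_0) (simp add: lessThan_atLeast0 add.commute)
  have "(\<Sum>m<n * K. ?f m) = (\<Sum>l<K. \<Sum>r<n. x * (b ^ r * \<theta> r * ?h r l))" for K
  proof -
    have "(\<Sum>m<n * K. ?f m) = (\<Sum>l<K. sum ?f {l * n..<l * n + n})"
      by (subst sum.nat_group) (simp add: mult.commute)
    also have "\<dots> = (\<Sum>l<K. \<Sum>r<n. ?f (r + l * n))"
      by (simp only: block)
    also have "\<dots> = (\<Sum>l<K. \<Sum>r<n. x * (b ^ r * \<theta> r * ?h r l))"
      by (intro sum.cong refl f_eq) simp
    finally show ?thesis .
  qed
  then have "(\<Sum>m<n * K. ?f m) = x * (\<Sum>r<n. b ^ r * \<theta> r * (\<Sum>l<K. ?h r l))" for K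
    by (subst (asm) sum.swap) (simp only: sum_distrib_left)
  moreover have "(\<lambda>K. x * (\<Sum>r<n. b ^ r * \<theta> r * (\<Sum>l<K. ?h r l))) \<longlonglongrightarrow>
      x * (\<Sum>r<n. b ^ r * \<theta> r * Lerch_Phi a s ((real r + 1 / 2) / real n))"
  proof (intro tendsto_mult tendsto_const tendsto_sum)
    fix r
    have "(real r + 1 / 2) / real n > 0" using n by simp
    then show "(\<lambda>K. \<Sum>l<K. ?h r l) \<longlonglongrightarrow> Lerch_Phi a s ((real r + 1 / 2) / real n)"
      using Lerch_Phi_sums[OF a s] by (simp only: sums_def)
  qed
  ultimately show ?thesis by (simp only:)
qed

text \<open>The column sums converge by the two preceding lemmas; the comparisons by columns and by
  rows carry this limit over to the row series, whose convergence is thereby obtained as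
  well.\<close>

lemma lattice_sum_limit:
  fixes p q n :: nat and a b :: real
  assumes p: "p \<ge> 1" "b = 1 \<Longrightarrow> p \<noteq> 1" and q: "q \<ge> 1" "a = 1 \<Longrightarrow> q \<noteq> 1" and n: "n \<ge> 1"
    and a: "a \<in> {1, - 1}" and bpq: "b = (- 1) ^ (p + q - 1)"
  defines "P \<equiv> (\<Sum>k=0..q div 2. real ((p + q - 2 * k - 1) choose (p - 1)) *
      (2 * (a * b ^ n) * Lerch_Phi (a * b ^ n) (2 * k) 1) * real n ^ (p + q - 2 * k) * Lerch_Phi b (p + q - 2 * k) (1 / 2))"
    and "R \<equiv> (\<Sum>j=1..p. real ((p + q - j - 1) choose (q - 1)) *
      (\<Sum>r<n. b ^ r * Lerch_Theta (a * b ^ n) j ((real r + 1 / 2) / real n) 1 *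
        Lerch_Phi a (p + q - j) ((real r + 1 / 2) / real n)))"
  shows "(\<lambda>K. \<Sum>k<K. a ^ Suc k / real (Suc k) ^ q *
      ((1 + (- 1) ^ q) * Lerch_Phi b p (1 / 2) - 2 * (- 1) ^ q * 2 ^ p * odd_harmonic p b (n * Suc k)))
    \<longlonglongrightarrow> (P + R) / real n ^ p"
proof -
  define c where "c = a * b ^ n"
  define \<theta> where "\<theta> j r = Lerch_Theta c j ((real r + 1 / 2) / real n) 1" for j r
  define z where "z m = (real m + 1 / 2) / real n" for m
  define B where "B k = real ((p + q - 2 * k - 1) choose (p - 1)) * (2 * c * Lerch_Phi c (2 * k) 1)" for k
  define C where "C j = real ((p + q - j - 1) choose (q - 1))" for j
  define G where "G m = ((\<Sum>k=0..q div 2. B k / z m ^ (p + q - 2 * k)) +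
      (\<Sum>j=1..p. C j * (c ^ (m div n) * \<theta> j (m mod n)) / z m ^ (p + q - j))) / real n ^ p" for m
  have b: "b \<in> {1, - 1}" unfolding bpq by (cases "even (p + q - 1)") auto
  have c: "c \<in> {1, - 1}" unfolding c_def using a b by (rule pm1_mult_power)
  have G: "(\<lambda>k. c ^ Suc k / real (Suc k) ^ q * lattice_kernel p q n m (Suc k)) sums G m" for m
  proof -
    let ?y = "(real (m mod n) + 1 / 2) / real n"
    have y: "0 < ?y" using n by simp
    have "real (Suc (m mod n)) \<le> real n" using n by (intro of_nat_mono) (simp add: Suc_leI)
    then have y1: "?y < 1" using n by simp
    have "real m = real (m div n) * real n + real (m mod n)"
      by (metis div_mult_mod_eq of_nat_add of_nat_mult)
    then have z: "z m = real (m div n) + ?y" using n by (simp add: z_def field_simps)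
    show ?thesis
      using sums_divide[OF kernel_series_sums[OF c p(1) q(1) y y1 z], of "real n ^ p"]
      unfolding G_def B_def C_def \<theta>_def lattice_kernel_rescale[OF n] z_def [symmetric] times_divide_eq_right .
  qed
  have "(\<lambda>K. \<Sum>k=0..q div 2. \<Sum>m<n * K. b ^ m * (B k / z m ^ (p + q - 2 * k))) \<longlonglongrightarrow>
      (\<Sum>k=0..q div 2. B k * real n ^ (p + q - 2 * k) * Lerch_Phi b (p + q - 2 * k) (1 / 2))"
    unfolding z_def
  proof (intro tendsto_sum zeta_part_tendsto b n)
    fix k assume "k \<in> {0..q div 2}"
    then have "2 * k \<le> q" by auto
    \<comment> \<open>Since \<open>2 * k <= q\<close>, the order is at least \<open>p\<close>, so
      convergence is inherited from the condition on \<open>b\<close> and \<open>p\<close>.\<close>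
    then show "p + q - 2 * k \<ge> 1" "b = 1 \<Longrightarrow> p + q - 2 * k \<noteq> 1" using p by auto
  qed
  then have P: "(\<lambda>K. \<Sum>k=0..q div 2. \<Sum>m<n * K. b ^ m * (B k / z m ^ (p + q - 2 * k))) \<longlonglongrightarrow> P"
    unfolding P_def B_def c_def .
  have "(\<lambda>K. \<Sum>j=1..p. \<Sum>m<n * K. b ^ m * (C j * ((a * b ^ n) ^ (m div n) * \<theta> j (m mod n)) / z m ^ (p + q - j))) \<longlonglongrightarrow>
      (\<Sum>j=1..p. C j * (\<Sum>r<n. b ^ r * \<theta> j r * Lerch_Phi a (p + q - j) ((real r + 1 / 2) / real n)))"
    unfolding z_def
  proof (intro tendsto_sum theta_part_tendsto a b n)
    fix j assume "j \<in> {1..p}"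
    \<comment> \<open>The order is at least \<open>q\<close>, so the condition on \<open>a\<close>
      and \<open>q\<close> applies.\<close>
    then show "p + q - j \<ge> 1" "a = 1 \<Longrightarrow> p + q - j \<noteq> 1" using q by auto
  qed
  then have R: "(\<lambda>K. \<Sum>j=1..p. \<Sum>m<n * K. b ^ m * (C j * (c ^ (m div n) * \<theta> j (m mod n)) / z m ^ (p + q - j))) \<longlonglongrightarrow> R"
    unfolding R_def C_def \<theta>_def c_def .
  have "(\<Sum>m<n * K. b ^ m * G m) = ((\<Sum>k=0..q div 2. \<Sum>m<n * K. b ^ m * (B k / z m ^ (p + q - 2 * k))) +
      (\<Sum>j=1..p. \<Sum>m<n * K. b ^ m * (C j * (c ^ (m div n) * \<theta> j (m mod n)) / z m ^ (p + q - j)))) / real n ^ p" for K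
    unfolding G_def times_divide_eq_right[of "b ^ _" _ "real n ^ p"] sum_divide_distrib [symmetric]
      distrib_left sum.distrib sum_distrib_left
    by (subst (1 2) sum.swap) (rule refl)
  moreover have "(\<lambda>K. ((\<Sum>k=0..q div 2. \<Sum>m<n * K. b ^ m * (B k / z m ^ (p + q - 2 * k))) +
      (\<Sum>j=1..p. \<Sum>m<n * K. b ^ m * (C j * (c ^ (m div n) * \<theta> j (m mod n)) / z m ^ (p + q - j)))) / real n ^ p)
      \<longlonglongrightarrow> (P + R) / real n ^ p"
    using n by (intro tendsto_divide tendsto_add P R tendsto_const) simp
  ultimately have lim: "(\<lambda>K. \<Sum>m<n * K. b ^ m * G m) \<longlonglongrightarrow> (P + R) / real n ^ p"
    by (simp only:)
  have "(\<lambda>K. \<Sum>k<K. c ^ Suc k / real (Suc k) ^ q * (\<Sum>m<n * K. b ^ m * lattice_kernel p q n m (Suc k)))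
      \<longlonglongrightarrow> (P + R) / real n ^ p"
    using tendsto_diff[OF lim truncated_lattice_sum_by_columns[OF b p q(1) n c G]] by simp
  from tendsto_diff[OF this truncated_lattice_sum_by_rows[OF a b p q(1) n bpq, folded c_def]]
  show ?thesis by simp
qed

section \<open>Solving for the odd harmonic series\<close>

theorem theorem6:
  fixes p q n :: nat and a b :: real
  assumes "p \<ge> 1" and "q \<ge> 1" and "n \<ge> 1"
    and "a \<in> {1, - 1}"
    and "b = (- 1) ^ (p + q - 1)"
    and "b = 1 \<Longrightarrow> p \<noteq> 1"
    and "a = 1 \<Longrightarrow> q \<noteq> 1"
  shows "(\<lambda>i. a ^ Suc i * odd_harmonic p b (n * Suc i) / real (Suc i) ^ q) sums
    (a / 2 * (1 + (- 1) ^ q) * 2 powi (- int p) * Lerch_Phi a q 1 * Lerch_Phi b p (1 / 2)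
     + a * b ^ (n - 1) * real n ^ q * (- 2) powi (- int p) *
         (\<Sum>k = 0..q div 2. real ((p + q - 2 * k - 1) choose (p - 1)) * real n powi (- 2 * int k) *
            Lerch_Phi (a * b ^ n) (2 * k) 1 * Lerch_Phi b (p + q - 2 * k) (1 / 2))
     + a * b / 2 * (- 2 * real n) powi (- int p) *
         (\<Sum>j = 1..n. \<Sum>k = 1..p. real ((p + q - k - 1) choose (q - 1)) * b ^ j * (- 1) ^ k *
            Lerch_Theta (a * b ^ n) k (real (2 * j - 1)) (real (2 * n)) *
            Lerch_Phi a (p + q - k) (real (2 * n - 2 * j + 1) / real (2 * n))))"
proof -
  note p = assms(1) assms(6) and q = assms(2) assms(7) and n = assms(3) and a = assms(4) and bpq = assms(5)
  define c where "c = a * b ^ n"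
  define e :: real where "e = (- 1) ^ q"
  have b: "b \<in> {1, - 1}" unfolding bpq by (cases "even (p + q - 1)") auto
  have c: "c \<in> {1, - 1}" unfolding c_def using a b by (rule pm1_mult_power)
  have ee: "e * e = 1" unfolding e_def by (simp flip: power_mult_distrib)
  have sgn: "- e = (- 1) ^ p * b"
  proof -
    obtain p' where "p = Suc p'" using p(1) by (cases p) auto
    then show ?thesis unfolding bpq e_def by (cases "even p'") (simp_all add: power_add)
  qed
  define S1 where "S1 = (\<Sum>k = 0..q div 2. real ((p + q - 2 * k - 1) choose (p - 1)) * real n powi (- 2 * int k) *
            Lerch_Phi (a * b ^ n) (2 * k) 1 * Lerch_Phi b (p + q - 2 * k) (1 / 2))"
  define S2 where "S2 = (\<Sum>j = 1..n. \<Sum>k = 1..p. real ((p + q - k - 1) choose (q - 1)) * b ^ j * (- 1) ^ k *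
            Lerch_Theta (a * b ^ n) k (real (2 * j - 1)) (real (2 * n)) *
            Lerch_Phi a (p + q - k) (real (2 * n - 2 * j + 1) / real (2 * n)))"
  define P where "P = (\<Sum>k=0..q div 2. real ((p + q - 2 * k - 1) choose (p - 1)) *
      (2 * c * Lerch_Phi c (2 * k) 1) * real n ^ (p + q - 2 * k) * Lerch_Phi b (p + q - 2 * k) (1 / 2))"
  define R where "R = (\<Sum>j=1..p. real ((p + q - j - 1) choose (q - 1)) *
      (\<Sum>r<n. b ^ r * Lerch_Theta c j ((real r + 1 / 2) / real n) 1 *
        Lerch_Phi a (p + q - j) ((real r + 1 / 2) / real n)))"
  have P: "P = real n ^ p * (2 * c * real n ^ q * S1)"
    unfolding P_def S1_def c_def [symmetric] sum_distrib_left
  proof (rule sum.cong [OF refl])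
    fix k assume "k \<in> {0..q div 2}"
    then have k: "2 * k \<le> q" by auto
    have "real n ^ (p + q - 2 * k) = real n ^ (p + q) / real n ^ (2 * k)"
      using k n by (intro power_diff) auto
    moreover have "real n powi (- 2 * int k) = 1 / real n ^ (2 * k)"
      by (simp add: power_int_minus power_int_def nat_mult_distrib inverse_eq_divide power_one_over)
    ultimately show "real ((p + q - 2 * k - 1) choose (p - 1)) * (2 * c * Lerch_Phi c (2 * k) 1) *
        real n ^ (p + q - 2 * k) * Lerch_Phi b (p + q - 2 * k) (1 / 2) =
      real n ^ p * (2 * c * real n ^ q * (real ((p + q - 2 * k - 1) choose (p - 1)) * real n powi (- 2 * int k) *
        Lerch_Phi c (2 * k) 1 * Lerch_Phi b (p + q - 2 * k) (1 / 2)))"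
      by (simp add: power_add)
  qed
  \<comment> \<open>Substitute \<open>r = n - j\<close>. Reflection brings Theta to the argument of
    the Lerch value; its factor \<open>c * (- 1) ^ k\<close> cancels the sign
    \<open>(- 1) ^ k\<close> and, with \<open>a * b ^ j\<close>, leaves
    \<open>b ^ (n - j)\<close>.\<close>
  have R: "R = a * S2"
  proof -
    have "a * S2 = (\<Sum>j = 1..n. \<Sum>k = 1..p. real ((p + q - k - 1) choose (q - 1)) *
       (b ^ (n - j) * Lerch_Theta c k ((real (n - j) + 1 / 2) / real n) 1 *
        Lerch_Phi a (p + q - k) ((real (n - j) + 1 / 2) / real n)))"
      unfolding S2_def c_def [symmetric] sum_distrib_left
    proof (intro sum.cong refl)
      fix j k assume "j \<in> {1..n}"
      then have j: "1 \<le> j" "j \<le> n" by auto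
      let ?y = "(real (n - j) + 1 / 2) / real n"
      have y: "real (2 * n - 2 * j + 1) / real (2 * n) = ?y"
        and y': "real (2 * j - 1) / real (2 * n) = 1 - ?y"
        using j by (simp_all add: of_nat_diff field_simps)
      have "Lerch_Theta c k (real (2 * j - 1)) (real (2 * n)) = c * (- 1) ^ k * Lerch_Theta c k ?y 1"
      proof -
        have "real (2 * n) \<noteq> 0" using n by simp
        then show ?thesis unfolding Lerch_Theta_rescale[OF \<open>real (2 * n) \<noteq> 0\<close>] y' by (intro Lerch_Theta_reflect c)
      qed
      moreover have "(- 1) ^ k * ((- 1) ^ k * x) = x" for x :: real
        by (simp flip: mult.assoc power_mult_distrib)
      moreover have "a * (b ^ j * c) = b ^ (n - j)"
      proof -
        have "b ^ n = b ^ (n - j) * b ^ j" unfolding power_add [symmetric] using j by simp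
        then have "a * (b ^ j * c) = (a * a) * b ^ (n - j) * (b ^ j * b ^ j)"
          unfolding c_def by (simp only: mult_ac)
        then show ?thesis using a unfolding pm1_power_mult_self[OF b] by auto
      qed
      ultimately show "a * (real ((p + q - k - 1) choose (q - 1)) * b ^ j * (- 1) ^ k *
          Lerch_Theta c k (real (2 * j - 1)) (real (2 * n)) *
          Lerch_Phi a (p + q - k) (real (2 * n - 2 * j + 1) / real (2 * n))) =
        real ((p + q - k - 1) choose (q - 1)) * (b ^ (n - j) * Lerch_Theta c k ?y 1 * Lerch_Phi a (p + q - k) ?y)"
        unfolding y by (simp add: mult_ac)
    qed
    also have "\<dots> = (\<Sum>r<n. \<Sum>k = 1..p. real ((p + q - k - 1) choose (q - 1)) *
       (b ^ r * Lerch_Theta c k ((real r + 1 / 2) / real n) 1 *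
        Lerch_Phi a (p + q - k) ((real r + 1 / 2) / real n)))"
      by (rule sum.reindex_bij_witness[of _ "\<lambda>r. n - r" "\<lambda>j. n - j"]) auto
    also have "\<dots> = R"
      unfolding R_def sum_distrib_left by (rule sum.swap)
    finally show ?thesis ..
  qed
  have "(\<lambda>i. a ^ i / (real i + 1) ^ q) sums Lerch_Phi a q 1"
    by (intro Lerch_Phi_sums a q) simp_all
  then have "(\<lambda>i. a * (a ^ i / (real i + 1) ^ q)) sums (a * Lerch_Phi a q 1)"
    by (rule sums_mult)
  then have A: "(\<lambda>i. a ^ Suc i / real (Suc i) ^ q) sums (a * Lerch_Phi a q 1)"
    by (simp add: add.commute)
  have "(\<lambda>i. a ^ Suc i / real (Suc i) ^ q *
      ((1 + e) * Lerch_Phi b p (1 / 2) - 2 * e * 2 ^ p * odd_harmonic p b (n * Suc i))) sums ((P + R) / real n ^ p)"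
    using lattice_sum_limit[OF p q n a bpq] unfolding sums_def P_def R_def c_def e_def .
  \<comment> \<open>Subtracting from the convergent series \<open>A\<close> isolates the odd
    harmonic part with coefficient \<open>2 * e * 2 ^ p\<close>. As \<open>e * e = 1\<close>, the
    factor \<open>e / (2 * 2 ^ p)\<close> inverts it.\<close>
  from sums_mult[OF sums_diff[OF sums_mult2[OF A, of "(1 + e) * Lerch_Phi b p (1 / 2)"] this], of "e / (2 * 2 ^ p)"]
  have "(\<lambda>i. e / (2 * 2 ^ p) * (a ^ Suc i / real (Suc i) ^ q * (2 * e * 2 ^ p * odd_harmonic p b (n * Suc i))))
     sums (e / (2 * 2 ^ p) * (a * Lerch_Phi a q 1 * ((1 + e) * Lerch_Phi b p (1 / 2)) - (P + R) / real n ^ p))"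
    by (simp only: right_diff_distrib cancel_ab_semigroup_add_class.diff_right_commute diff_diff_eq2 diff_add_cancel
        add_diff_cancel_left')
  moreover have "e / (2 * 2 ^ p) * (x / y * (2 * e * 2 ^ p * h)) = x * h / y" for x y h :: real
  proof -
    have "e / (2 * 2 ^ p) * (x / y * (2 * e * 2 ^ p * h)) = (e * e) * (x * h / y)" by simp
    then show ?thesis by (simp add: ee)
  qed
  ultimately have main: "(\<lambda>i. a ^ Suc i * odd_harmonic p b (n * Suc i) / real (Suc i) ^ q) sums
    (e / (2 * 2 ^ p) * (a * Lerch_Phi a q 1 * ((1 + e) * Lerch_Phi b p (1 / 2)) - (P + R) / real n ^ p))"
    by (simp only:)
  have pow2: "(2 :: real) powi (- int p) = 1 / 2 ^ p"
    by (simp add: power_int_minus inverse_eq_divide)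
  have powm: "(- x) powi (- int p) = (- 1) ^ p / x ^ p" for x :: real
    by (cases "even p") (simp_all add: power_int_minus inverse_eq_divide)
  have "e * (1 + e) = 1 + e" using ee by (simp add: algebra_simps)
  then have 1: "e / (2 * 2 ^ p) * (a * Lerch_Phi a q 1 * ((1 + e) * Lerch_Phi b p (1 / 2))) =
      a / 2 * (1 + (- 1) ^ q) * 2 powi (- int p) * Lerch_Phi a q 1 * Lerch_Phi b p (1 / 2)"
    unfolding pow2 e_def [symmetric] by (simp add: field_simps)
  have "b * b ^ n = b ^ (n - 1)"
  proof -
    obtain n' where "n = Suc n'" using n by (cases n) auto
    then show ?thesis using b by auto
  qed
  \<comment> \<open>The sign \<open>- e = (- 1) ^ p * b\<close> supplies both the negative base of
    the powers with exponent \<open>- p\<close> and the factor \<open>b\<close> that lowers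
    \<open>b ^ n\<close> to \<open>b ^ (n - 1)\<close>.\<close>
  then have "- e * c = (- 1) ^ p * (a * b ^ (n - 1))"
    unfolding sgn c_def by (simp add: mult_ac)
  then have 2: "- e / (2 * 2 ^ p) * (2 * c * real n ^ q * S1) = a * b ^ (n - 1) * real n ^ q * (- 2) powi (- int p) * S1"
  proof -
    have "- e / (2 * 2 ^ p) * (2 * c * real n ^ q * S1) = (- e * c) * real n ^ q * S1 / 2 ^ p" by simp
    also note \<open>- e * c = (- 1) ^ p * (a * b ^ (n - 1))\<close>
    finally show ?thesis unfolding powm by (simp add: mult_ac)
  qed
  have 3: "- e / (2 * 2 ^ p) * (a * S2 / real n ^ p) = a * b / 2 * (- 2 * real n) powi (- int p) * S2"
    using n powm[of "2 * real n"] unfolding sgn by (simp add: field_simps)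
  have eq: "e / (2 * 2 ^ p) * (a * Lerch_Phi a q 1 * ((1 + e) * Lerch_Phi b p (1 / 2)) - (P + R) / real n ^ p) =
      e / (2 * 2 ^ p) * (a * Lerch_Phi a q 1 * ((1 + e) * Lerch_Phi b p (1 / 2)))
      + - e / (2 * 2 ^ p) * (2 * c * real n ^ q * S1) + - e / (2 * 2 ^ p) * (a * S2 / real n ^ p)"
    using n unfolding P R by (simp add: add_divide_distrib right_diff_distrib distrib_left)
  show ?thesis
    using main unfolding eq[unfolded 1 2 3] S1_def S2_def .
qed

end
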